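(* Let $K$ be a convex body in $\mathbb{R}^n$ in John's position, let $(c_j,v_j)_{j=1}^m\subseteq(0,1]\times(\partial K\cap S^{n-1})$ be its associated decomposition of the identity, and let $H$ be a $k$-dimensional linear subspace of $\mathbb{R}^n$. Let $F=H\times\mathbb{R}\subseteq\mathbb{R}^{n+1}$ and, for $1\le j\le m$, let $$\tilde v_j=\sqrt{\tfrac{n}{n+1}}\Big(-v_j,\tfrac{1}{\sqrt n}\Big)\in S^n,\qquad\delta_j=\tfrac{n+1}{n}c_j,\qquad\tilde\delta_j=\delta_j\|P_F\tilde v_j\|_2^2.$$ Assume that $\tilde\delta_j\ge\frac12$ for every $1\le j\le m$. Then $$\mathrm{vol}_k(K\cap H)\le\mathrm{vol}_k(S_k)\,2^{\frac{k+1-m}{2}}\,\frac{n^{\frac k2}(n+1)^{\frac{k+1}{2}}}{k^{\frac k2}(k+1)^{\frac{k+1}{2}}}\left(\frac{2k-n+1}{m-2(n-k)}\right)^{-\frac{2k-n+1}{2}},$$ where the last factor is understood as $1$ if $2k-n+1=0$.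
   Context: A convex body $K\subseteq\mathbb{R}^n$ is in John's position if the maximal volume ellipsoid contained in $K$ is the Euclidean unit ball $B_2^n$. This holds if and only if $B_2^n\subseteq K$ and there exist $v_1,\dots,v_m\in\partial K\cap S^{n-1}$ and $c_1,\dots,c_m\in(0,1]$ with $\mathrm{Id}_n=\sum_{j=1}^mc_jv_j\otimes v_j$ and $\sum_{j=1}^mc_jv_j=0$; such a family is called an associated decomposition of the identity. $S_k$ denotes the $k$-dimensional regular simplex in John's position (i.e. whose inscribed ball is $B_2^k$). $P_F$ is the orthogonal projection in $\mathbb{R}^{n+1}$ onto $F$. *)

theory Defs
  imports "HOL-Analysis.Analysis"
begin

(* The (dim V)-dimensional Lebesgue measure on a linear subspace V is the image of the product
   measure under the coordinates of an orthonormal basis of V, just as lborel is defined from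
   Basis.  The choice of the basis is immaterial (lemmas subspace_lborel_onb and
   subspace_lborel_UNIV below).  For V = {0} it is the unit point mass at 0. *)

definition onb :: "'a::euclidean_space set \<Rightarrow> 'a set \<Rightarrow> bool" where
  "onb V B \<longleftrightarrow> B \<subseteq> V \<and> pairwise orthogonal B \<and> (\<forall>b\<in>B. norm b = 1) \<and> span B = V"

definition onb_lborel :: "'a::euclidean_space set \<Rightarrow> 'a measure" where
  "onb_lborel B = distr (\<Pi>\<^sub>M b\<in>B. (lborel :: real measure)) borel (\<lambda>x. \<Sum>b\<in>B. x b *\<^sub>R b)"

definition subspace_lborel :: "'a::euclidean_space set \<Rightarrow> 'a measure" where
  "subspace_lborel V = onb_lborel (SOME B. onb V B)"

definition ellipsoid_in :: "'a::euclidean_space set \<Rightarrow> 'a set \<Rightarrow> bool" where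
  "ellipsoid_in V E \<longleftrightarrow>
     (\<exists>T a. linear T \<and> T ` V = V \<and> a \<in> V \<and> E = (\<lambda>x. a + T x) ` (cball 0 1 \<inter> V))"

(* Maximality is required in the non-strict sense; the maximal volume ellipsoid of a convex
   body is unique by John's theorem. *)

definition johns_position :: "'a::euclidean_space set \<Rightarrow> 'a set \<Rightarrow> bool" where
  "johns_position V K \<longleftrightarrow>
     cball 0 1 \<inter> V \<subseteq> K \<and>
     (\<forall>E. ellipsoid_in V E \<and> E \<subseteq> K \<longrightarrow>
        measure (subspace_lborel V) E \<le> measure (subspace_lborel V) (cball 0 1 \<inter> V))"

definition john_decomposition ::
    "'a::euclidean_space set \<Rightarrow> nat \<Rightarrow> (nat \<Rightarrow> real) \<Rightarrow> (nat \<Rightarrow> 'a) \<Rightarrow> bool" where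
  "john_decomposition K m c v \<longleftrightarrow>
     (\<forall>j\<in>{1..m}. 0 < c j \<and> c j \<le> 1 \<and> v j \<in> frontier K \<inter> sphere 0 1) \<and>
     (\<lambda>x. \<Sum>j=1..m. c j *\<^sub>R ((v j \<bullet> x) *\<^sub>R v j)) = id \<and>
     (\<Sum>j=1..m. c j *\<^sub>R v j) = 0"

definition regular_simplex :: "nat \<Rightarrow> 'a::euclidean_space set \<Rightarrow> bool" where
  "regular_simplex k S \<longleftrightarrow>
     (\<exists>C d. \<not> affine_dependent C \<and> card C = k + 1 \<and>
        (\<forall>x\<in>C. \<forall>y\<in>C. x \<noteq> y \<longrightarrow> dist x y = d) \<and> S = convex hull C)"

definition orth_proj :: "'a::euclidean_space set \<Rightarrow> 'a \<Rightarrow> 'a" where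
  "orth_proj F x = (THE y. y \<in> F \<and> (\<forall>z\<in>F. orthogonal (x - y) z))"

lemma onb_exists:
  assumes "subspace V"
  shows "\<exists>B. onb V B"
  using orthonormal_basis_subspace[OF assms] unfolding onb_def by metis

lemma onb_inner:
  assumes "onb V B" "a \<in> B" "b \<in> B"
  shows "a \<bullet> b = (if a = b then 1 else 0)"
  using assms by (auto simp: onb_def pairwise_def orthogonal_def dot_square_norm)

lemma onb_independent:
  assumes "onb V B"
  shows "independent B"
  using assms pairwise_orthogonal_independent[of B] unfolding onb_def by force

lemma onb_finite:
  assumes "onb V B"
  shows "finite B"
  using onb_independent[OF assms] by (rule independent_imp_finite)

lemma onb_card:
  assumes "onb V B"
  shows "card B = dim V"
  using dim_eq_card[of B V] onb_independent[OF assms] assms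
  by (metis onb_def span_span)

lemma onb_expand:
  assumes "onb V B" "w \<in> V"
  shows "(\<Sum>b\<in>B. (w \<bullet> b) *\<^sub>R b) = w"
proof -
  have "pairwise orthogonal B" "w \<in> span B" "\<And>b. b \<in> B \<Longrightarrow> norm b = 1"
    using assms by (auto simp: onb_def)
  then show ?thesis
    using orthonormal_basis_expand[of B w] onb_finite[OF assms(1)] by simp
qed

lemma onb_norm:
  assumes "onb V B"
  shows "norm (\<Sum>b\<in>B. x b *\<^sub>R b) = sqrt (\<Sum>b\<in>B. (x b)\<^sup>2)"
proof -
  have "(\<Sum>a\<in>B. x a *\<^sub>R a) \<bullet> (\<Sum>b\<in>B. x b *\<^sub>R b) = (\<Sum>a\<in>B. \<Sum>b\<in>B. x a * (x b * (a \<bullet> b)))"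
    by (simp add: inner_sum_left inner_sum_right sum_distrib_left)
      (subst sum.swap, simp add: mult_ac)
  also have "\<dots> = (\<Sum>a\<in>B. \<Sum>b\<in>B. if b = a then (x a)\<^sup>2 else 0)"
    by (intro sum.cong refl) (auto simp: onb_inner[OF assms] power2_eq_square)
  also have "\<dots> = (\<Sum>a\<in>B. (x a)\<^sup>2)"
    using onb_finite[OF assms] by simp
  finally show ?thesis by (simp add: norm_eq_sqrt_inner)
qed

lemma distr_PiM_lborel:
  fixes p :: "'b \<Rightarrow> 'c" and w :: "'b \<Rightarrow> real"
  assumes fin: "finite B" and p: "bij_betw p B C"
  shows "distr (\<Pi>\<^sub>M c\<in>C. lborel) (\<Pi>\<^sub>M b\<in>B. lborel) (\<lambda>x. \<lambda>b\<in>B. w b + x (p b))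
         = (\<Pi>\<^sub>M b\<in>B. (lborel :: real measure))"
proof -
  let ?f = "\<lambda>x. \<lambda>b\<in>B. w b + x (p b)"
  interpret B: product_sigma_finite "\<lambda>_ :: 'b. lborel :: real measure" ..
  interpret C: product_sigma_finite "\<lambda>_ :: 'c. lborel :: real measure" ..
  have finC: "finite C" using fin p bij_betw_finite by blast
  have pC: "p b \<in> C" if "b \<in> B" for b using p that by (auto simp: bij_betw_def)
  have f: "?f \<in> measurable (\<Pi>\<^sub>M c\<in>C. lborel) (\<Pi>\<^sub>M b\<in>B. lborel)"
    by (intro measurable_restrict) (use pC in measurable)
  have inv: "the_inv_into B p (p b) = b" if "b \<in> B" for b
    using p that by (simp add: bij_betw_def the_inv_into_f_f)
  show ?thesis
  proof (rule B.PiM_eqI[OF fin])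
    fix A :: "'b \<Rightarrow> real set"
    assume A: "\<And>i. i \<in> B \<Longrightarrow> A i \<in> sets lborel"
    define D where "D = (\<lambda>b. (\<lambda>t. w b + t) -` A b)"
    have sh: "emeasure lborel (D b) = emeasure lborel (A b)" "D b \<in> sets lborel"
      if "b \<in> B" for b
    proof -
      have m: "(\<lambda>t. w b + t) \<in> borel_measurable borel" by simp
      show "D b \<in> sets lborel"
        using measurable_sets[OF m, of "A b"] A[OF that] by (simp add: D_def)
      have "emeasure lborel (A b) = emeasure (distr lborel borel (\<lambda>t. w b + t)) (A b)"
        by (simp add: lborel_distr_plus)
      also have "\<dots> = emeasure lborel (D b)"
        using A[OF that] by (subst emeasure_distr) (auto simp: D_def)
      finally show "emeasure lborel (D b) = emeasure lborel (A b)" by simp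
    qed
    have "?f -` (Pi\<^sub>E B A) \<inter> space (\<Pi>\<^sub>M c\<in>C. (lborel :: real measure))
          = Pi\<^sub>E C (\<lambda>c. D (the_inv_into B p c))" (is "?L = ?R")
    proof (intro equalityI subsetI)
      fix x assume x: "x \<in> ?L"
      have "x c \<in> D (the_inv_into B p c)" if c: "c \<in> C" for c
      proof -
        obtain b where "b \<in> B" "c = p b" using p c by (auto simp: bij_betw_def)
        then show ?thesis using x inv by (auto simp: D_def PiE_iff)
      qed
      then show "x \<in> ?R" using x by (auto simp: space_PiM PiE_iff)
    next
      fix x assume x: "x \<in> ?R"
      have "x (p b) \<in> D b" if "b \<in> B" for b
        using x pC[OF that] inv[OF that] by (metis (no_types, lifting) PiE_mem)
      then show "x \<in> ?L" using x by (auto simp: space_PiM PiE_iff D_def)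
    qed
    then have "emeasure (distr (\<Pi>\<^sub>M c\<in>C. lborel) (\<Pi>\<^sub>M b\<in>B. lborel) ?f) (Pi\<^sub>E B A)
        = emeasure (\<Pi>\<^sub>M c\<in>C. lborel) (Pi\<^sub>E C (\<lambda>c. D (the_inv_into B p c)))"
      using A fin by (subst emeasure_distr[OF f]) (auto intro!: sets_PiM_I_finite)
    also have "\<dots> = (\<Prod>c\<in>C. emeasure lborel (D (the_inv_into B p c)))"
    proof (rule C.emeasure_PiM[OF finC])
      fix c assume "c \<in> C"
      then obtain b where "b \<in> B" "c = p b" using p by (auto simp: bij_betw_def)
      then show "D (the_inv_into B p c) \<in> sets lborel" using sh inv by simp
    qed
    also have "\<dots> = (\<Prod>b\<in>B. emeasure lborel (D (the_inv_into B p (p b))))"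
      by (rule prod.reindex_bij_betw[OF p, symmetric])
    also have "\<dots> = (\<Prod>b\<in>B. emeasure lborel (A b))"
      by (intro prod.cong refl) (simp add: inv sh)
    finally show "emeasure (distr (\<Pi>\<^sub>M c\<in>C. lborel) (\<Pi>\<^sub>M b\<in>B. lborel) ?f) (Pi\<^sub>E B A)
        = (\<Prod>b\<in>B. emeasure lborel (A b))" .
  qed simp
qed

lemma onb_map_measurable [measurable]:
  "(\<lambda>x. \<Sum>b\<in>B. x b *\<^sub>R (b :: 'a::euclidean_space))
     \<in> borel_measurable (\<Pi>\<^sub>M b\<in>B. (lborel :: real measure))"
  by measurable

lemma sets_onb_lborel [simp, measurable_cong]: "sets (onb_lborel B) = sets borel"
  by (simp add: onb_lborel_def)

lemma space_onb_lborel [simp]: "space (onb_lborel B) = UNIV"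
  by (simp add: onb_lborel_def)

lemma nn_integral_onb_lborel:
  assumes "g \<in> borel_measurable borel"
  shows "(\<integral>\<^sup>+z. g z \<partial>onb_lborel B)
    = (\<integral>\<^sup>+x. g (\<Sum>b\<in>B. x b *\<^sub>R b) \<partial>(\<Pi>\<^sub>M b\<in>B. (lborel :: real measure)))"
  unfolding onb_lborel_def using assms by (subst nn_integral_distr) auto

lemma nn_integral_onb_translate:
  fixes g :: "'a::euclidean_space \<Rightarrow> ennreal"
  assumes B: "onb V B" and w: "w \<in> V" and [measurable]: "g \<in> borel_measurable borel"
  shows "(\<integral>\<^sup>+x. g ((\<Sum>b\<in>B. x b *\<^sub>R b) + w) \<partial>(\<Pi>\<^sub>M b\<in>B. (lborel :: real measure)))
       = (\<integral>\<^sup>+x. g (\<Sum>b\<in>B. x b *\<^sub>R b) \<partial>(\<Pi>\<^sub>M b\<in>B. lborel))"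
proof -
  let ?P = "\<Pi>\<^sub>M b\<in>B. (lborel :: real measure)"
  let ?f = "\<lambda>x. \<lambda>b\<in>B. w \<bullet> b + x (id b)"
  have f: "?f \<in> measurable ?P ?P"
    by (intro measurable_restrict) measurable
  have eq: "distr ?P ?P ?f = ?P"
    using onb_finite[OF B] by (rule distr_PiM_lborel) (rule bij_betw_id)
  have "(\<integral>\<^sup>+x. g (\<Sum>b\<in>B. x b *\<^sub>R b) \<partial>?P) = (\<integral>\<^sup>+x. g (\<Sum>b\<in>B. x b *\<^sub>R b) \<partial>(distr ?P ?P ?f))"
    by (simp only: eq)
  also have "\<dots> = (\<integral>\<^sup>+x. g (\<Sum>b\<in>B. ?f x b *\<^sub>R b) \<partial>?P)"
    by (rule nn_integral_distr[OF f]) measurable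
  also have "\<dots> = (\<integral>\<^sup>+x. g ((\<Sum>b\<in>B. x b *\<^sub>R b) + w) \<partial>?P)"
  proof (rule nn_integral_cong)
    fix x :: "'a \<Rightarrow> real"
    have "(\<Sum>b\<in>B. ?f x b *\<^sub>R b) = (\<Sum>b\<in>B. x b *\<^sub>R b) + (\<Sum>b\<in>B. (w \<bullet> b) *\<^sub>R b)"
      by (simp add: scaleR_add_left sum.distrib)
    then show "g (\<Sum>b\<in>B. ?f x b *\<^sub>R b) = g ((\<Sum>b\<in>B. x b *\<^sub>R b) + w)"
      using onb_expand[OF B w] by simp
  qed
  finally show ?thesis by simp
qed

lemma emeasure_onb_lborel:
  assumes "A \<in> sets borel"
  shows "emeasure (onb_lborel B) A
    = emeasure (\<Pi>\<^sub>M b\<in>B. (lborel :: real measure))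
        ((\<lambda>x. \<Sum>b\<in>B. x b *\<^sub>R b) -` A \<inter> space (\<Pi>\<^sub>M b\<in>B. (lborel :: real measure)))"
  unfolding onb_lborel_def using assms by (subst emeasure_distr) auto

lemma onb_unit_ball:
  assumes B: "onb V B"
  shows "emeasure (onb_lborel B) (cball 0 1) \<noteq> 0"
    and "emeasure (onb_lborel B) (cball 0 1) \<noteq> \<infinity>"
proof -
  interpret product_sigma_finite "\<lambda>_ :: 'a. lborel :: real measure" ..
  let ?P = "\<Pi>\<^sub>M b\<in>B. (lborel :: real measure)"
  let ?U = "(\<lambda>x. \<Sum>b\<in>B. x b *\<^sub>R b) -` cball 0 1 \<inter> space ?P"
  have fin: "finite B" using B by (rule onb_finite)
  have U: "?U \<in> sets ?P" by measurable
  define r where "r = 1 / (real (card B) + 1)"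
  have r: "0 < r" "real (card B) * r \<le> 1" by (simp_all add: r_def field_simps)
  have b1: "norm b = 1" if "b \<in> B" for b using B that by (simp add: onb_def)
  have "Pi\<^sub>E B (\<lambda>_. {0..r}) \<subseteq> ?U"
  proof
    fix x assume x: "x \<in> Pi\<^sub>E B (\<lambda>_. {0..r})"
    have "norm (\<Sum>b\<in>B. x b *\<^sub>R b) \<le> (\<Sum>b\<in>B. r)"
    proof (rule sum_norm_le)
      fix b assume b: "b \<in> B"
      then have "x b \<in> {0..r}" using x by (auto simp: PiE_iff)
      then show "norm (x b *\<^sub>R b) \<le> r" using b1[OF b] by simp
    qed
    then show "x \<in> ?U" using x r by (auto simp: space_PiM PiE_iff)
  qed
  then have "emeasure ?P (Pi\<^sub>E B (\<lambda>_. {0..r})) \<le> emeasure ?P ?U"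
    using U by (rule emeasure_mono)
  moreover have "emeasure ?P (Pi\<^sub>E B (\<lambda>_. {0..r})) = (\<Prod>b\<in>B. ennreal r)"
    using fin r by (subst emeasure_PiM) auto
  moreover have "(\<Prod>b\<in>B. ennreal r) \<noteq> 0" using r fin by simp
  ultimately show "emeasure (onb_lborel B) (cball 0 1) \<noteq> 0"
    by (auto simp: emeasure_onb_lborel)
  have "?U \<subseteq> Pi\<^sub>E B (\<lambda>_. {-1..1})"
  proof
    fix x assume x: "x \<in> ?U"
    have "\<bar>x b\<bar> \<le> 1" if b: "b \<in> B" for b
    proof -
      have "(x b)\<^sup>2 \<le> (\<Sum>b\<in>B. (x b)\<^sup>2)"
        using fin b by (intro member_le_sum) auto
      also have "\<dots> \<le> 1"
        using x by (simp add: onb_norm[OF B])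
      finally show ?thesis by (simp add: abs_square_le_1)
    qed
    then show "x \<in> Pi\<^sub>E B (\<lambda>_. {-1..1})"
      using x by (auto simp: space_PiM PiE_iff abs_le_iff minus_le_iff)
  qed
  then have "emeasure ?P ?U \<le> emeasure ?P (Pi\<^sub>E B (\<lambda>_. {-1..1}))"
    using fin by (intro emeasure_mono sets_PiM_I_finite) auto
  also have "\<dots> = (\<Prod>b\<in>B. ennreal 2)"
    using fin by (subst emeasure_PiM) auto
  also have "\<dots> < \<infinity>"
    using fin by (simp add: prod_constant power_less_top_ennreal)
  finally show "emeasure (onb_lborel B) (cball 0 1) \<noteq> \<infinity>"
    by (simp add: emeasure_onb_lborel)
qed

lemma onb_unit_ball_eq:
  assumes B: "onb V B" and C: "onb V C"
  shows "emeasure (onb_lborel B) (cball 0 1) = emeasure (onb_lborel C) (cball 0 1)"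
proof -
  let ?P = "\<lambda>B. \<Pi>\<^sub>M b\<in>B. (lborel :: real measure)"
  have fin: "finite B" "finite C" using B C onb_finite by auto
  obtain p where p: "bij_betw p B C"
    using finite_same_card_bij[OF fin] onb_card[OF B] onb_card[OF C] by auto
  let ?f = "\<lambda>x. \<lambda>b\<in>B. 0 + x (p b)"
  have pC: "p b \<in> C" if "b \<in> B" for b using p that by (auto simp: bij_betw_def)
  have f: "?f \<in> measurable (?P C) (?P B)"
    by (intro measurable_restrict) (use pC in measurable)
  let ?U = "\<lambda>B. (\<lambda>x. \<Sum>b\<in>B. x b *\<^sub>R b) -` cball 0 1 \<inter> space (?P B)"
  have "emeasure (?P B) (?U B) = emeasure (distr (?P C) (?P B) ?f) (?U B)"
    by (simp only: distr_PiM_lborel[OF fin(1) p])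
  also have "\<dots> = emeasure (?P C) (?f -` ?U B \<inter> space (?P C))"
    by (rule emeasure_distr[OF f]) measurable
  also have "?f -` ?U B \<inter> space (?P C) = ?U C"
  proof -
    have "norm (\<Sum>b\<in>B. ?f x b *\<^sub>R b) = norm (\<Sum>c\<in>C. x c *\<^sub>R c)" for x
    proof -
      have "(\<Sum>b\<in>B. (?f x b)\<^sup>2) = (\<Sum>b\<in>B. (x (p b))\<^sup>2)"
        by (intro sum.cong) auto
      also have "\<dots> = (\<Sum>c\<in>C. (x c)\<^sup>2)"
        by (rule sum.reindex_bij_betw[OF p])
      finally show ?thesis by (simp only: onb_norm[OF B] onb_norm[OF C])
    qed
    moreover have "?f x \<in> space (?P B)" for x by (auto simp: space_PiM)
    ultimately show ?thesis by auto
  qed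
  finally show ?thesis by (simp add: emeasure_onb_lborel)
qed

lemma onb_lborel_unique:
  fixes B C V :: "'a::euclidean_space set"
  assumes B: "onb V B" and C: "onb V C"
  shows "onb_lborel B = onb_lborel C"
proof (rule measure_eqI)
  fix A :: "'a set" assume "A \<in> sets (onb_lborel B)"
  then have A [measurable]: "A \<in> sets borel" by simp
  let ?PB = "\<Pi>\<^sub>M b\<in>B. (lborel :: real measure)"
  let ?PC = "\<Pi>\<^sub>M b\<in>C. (lborel :: real measure)"
  let ?\<phi> = "\<lambda>B x. \<Sum>b\<in>B. x b *\<^sub>R (b :: 'a)"
  define U :: "'a set" where "U = cball 0 1"
  have [measurable]: "U \<in> sets borel" by (simp add: U_def)
  have Um: "- z \<in> U \<longleftrightarrow> z \<in> U" for z by (simp add: U_def)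
  interpret product_sigma_finite "\<lambda>_ :: 'a. lborel :: real measure" ..
  interpret PB: sigma_finite_measure ?PB by (rule sigma_finite[OF onb_finite[OF B]])
  interpret PC: sigma_finite_measure ?PC by (rule sigma_finite[OF onb_finite[OF C]])
  interpret P: pair_sigma_finite ?PB ?PC ..
  have inV: "?\<phi> B x \<in> V" "?\<phi> C x \<in> V" for x
    using B C span_sum[of B "\<lambda>b. x b *\<^sub>R b" B] span_sum[of C "\<lambda>b. x b *\<^sub>R b" C]
    by (auto simp: onb_def intro: span_scale span_base)
  have neg: "- z \<in> V" if "z \<in> V" for z
    using that B by (metis onb_def span_neg)
  have tr: "(\<integral>\<^sup>+y. indicator U (?\<phi> C y - w) \<partial>?PC) = emeasure (onb_lborel C) U"
    if "w \<in> V" for w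
    using nn_integral_onb_translate[OF C neg[OF that], of "indicator U"]
      nn_integral_onb_lborel[of "indicator U" C] by simp
  have tr': "(\<integral>\<^sup>+y. indicator A (w + ?\<phi> C y) \<partial>?PC) = emeasure (onb_lborel C) A"
    if "w \<in> V" for w
    using nn_integral_onb_translate[OF C that, of "indicator A"]
      nn_integral_onb_lborel[of "indicator A" C] by (simp add: add.commute)
  have "emeasure (onb_lborel B) A * emeasure (onb_lborel C) U
      = (\<integral>\<^sup>+x. indicator A (?\<phi> B x) * emeasure (onb_lborel C) U \<partial>?PB)"
    using nn_integral_onb_lborel[of "indicator A" B] by (simp add: nn_integral_multc)
  also have "\<dots> = (\<integral>\<^sup>+x. \<integral>\<^sup>+y. indicator A (?\<phi> B x) * indicator U (?\<phi> C y - ?\<phi> B x) \<partial>?PC \<partial>?PB)"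
    by (intro nn_integral_cong) (simp add: nn_integral_cmult tr inV)
  also have "\<dots> = (\<integral>\<^sup>+y. \<integral>\<^sup>+x. indicator A (?\<phi> B x) * indicator U (?\<phi> C y - ?\<phi> B x) \<partial>?PB \<partial>?PC)"
    by (rule P.Fubini'[symmetric]) measurable
  also have "\<dots> = (\<integral>\<^sup>+y. \<integral>\<^sup>+x. indicator A (?\<phi> B x + ?\<phi> C y) * indicator U (?\<phi> B x) \<partial>?PB \<partial>?PC)"
  proof (rule nn_integral_cong)
    fix y
    have "(\<integral>\<^sup>+x. indicator A (?\<phi> B x) * indicator U (?\<phi> C y - ?\<phi> B x) \<partial>?PB)
        = (\<integral>\<^sup>+x. indicator A (?\<phi> B x + ?\<phi> C y) * indicator U (?\<phi> C y - (?\<phi> B x + ?\<phi> C y)) \<partial>?PB)"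
      by (rule nn_integral_onb_translate[OF B inV(2), symmetric,
            where g = "\<lambda>z. indicator A z * indicator U (?\<phi> C y - z)"]) measurable
    also have "\<dots> = (\<integral>\<^sup>+x. indicator A (?\<phi> B x + ?\<phi> C y) * indicator U (?\<phi> B x) \<partial>?PB)"
      by (simp add: indicator_def Um)
    finally show "(\<integral>\<^sup>+x. indicator A (?\<phi> B x) * indicator U (?\<phi> C y - ?\<phi> B x) \<partial>?PB)
        = (\<integral>\<^sup>+x. indicator A (?\<phi> B x + ?\<phi> C y) * indicator U (?\<phi> B x) \<partial>?PB)" .
  qed
  also have "\<dots> = (\<integral>\<^sup>+x. \<integral>\<^sup>+y. indicator A (?\<phi> B x + ?\<phi> C y) * indicator U (?\<phi> B x) \<partial>?PC \<partial>?PB)"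
    by (rule P.Fubini') measurable
  also have "\<dots> = (\<integral>\<^sup>+x. emeasure (onb_lborel C) A * indicator U (?\<phi> B x) \<partial>?PB)"
    by (intro nn_integral_cong) (simp add: nn_integral_multc tr' inV)
  also have "\<dots> = emeasure (onb_lborel C) A * emeasure (onb_lborel B) U"
    using nn_integral_onb_lborel[of "indicator U" B] by (simp add: nn_integral_cmult)
  also have "emeasure (onb_lborel B) U = emeasure (onb_lborel C) U"
    unfolding U_def by (rule onb_unit_ball_eq[OF B C])
  finally show "emeasure (onb_lborel B) A = emeasure (onb_lborel C) A"
    using onb_unit_ball[OF C] unfolding U_def
    by (simp add: mult.commute[of _ "emeasure (onb_lborel C) (cball 0 1)"] ennreal_mult_cancel_left)
qed simp

lemma subspace_lborel_onb:
  assumes "onb V B"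
  shows "subspace_lborel V = onb_lborel B"
  unfolding subspace_lborel_def
  by (rule onb_lborel_unique[OF someI[of "onb V", OF assms] assms])

lemma subspace_lborel_UNIV: "subspace_lborel (UNIV :: 'a::euclidean_space set) = lborel"
proof -
  have "onb UNIV Basis"
    by (auto simp: onb_def pairwise_def orthogonal_def inner_Basis)
  then have "subspace_lborel (UNIV :: 'a set) = onb_lborel Basis"
    by (rule subspace_lborel_onb)
  then show ?thesis
    by (simp add: onb_lborel_def lborel_eq_real lborel_def[where 'a = 'a])
qed

end

theory Submission
  imports Defs "HOL-Probability.Distributions" "HOL-Probability.Distribution_Functions"
begin

text \<open>The section is lifted to \<open>F = H \<times> \<real>\<close>, a space of dimension \<open>k + 1\<close>.  The vectors
  \<open>vt j\<close> with the weights \<open>\<delta> j\<close> decompose the identity of \<open>\<real>\<^sup>n \<times> \<real>\<close>, and therefore the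
  normalised projections \<open>u j\<close> of the \<open>vt j\<close> to \<open>F\<close> with the weights \<open>\<delta>t j\<close> decompose the
  identity of \<open>F\<close>.  Since \<open>K\<close> lies in the half-spaces \<open>v j \<bullet> x \<le> 1\<close> (\<open>contact_point_halfspace\<close>), the cone over \<open>K \<inter> H\<close> whose slice at height \<open>r\<close> is
  \<open>(r / sqrt n) (K \<inter> H)\<close> is contained in the cone of all \<open>z \<in> F\<close> with \<open>u j \<bullet> z \<ge> 0\<close> for every
  \<open>j\<close>.  Now integrate \<open>exp (- sqrt (n + 1) r)\<close>.  Over the small cone the integral is an explicit
  multiple of the volume of \<open>K \<inter> H\<close> (\<open>nn_integral_cone\<close>).  Over the large cone the integrand is a
  product of exponentials in the \<open>u j \<bullet> z\<close>, and the geometric Brascamp-Lieb inequality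
  (\<open>brascamp_lieb_exponential\<close>) bounds the integral by the product of the
  \<open>sqrt (\<delta>t j / \<delta> j) powr \<delta>t j\<close>.

  All weights lie in \<open>[1/2, 1]\<close> and \<open>\<delta>t j \<le> \<delta> j\<close>, so that \<open>\<delta> j / \<delta>t j\<close> lies in \<open>[1, 2]\<close>, where
  \<open>ln\<close> is above its chord \<open>(x - 1) ln 2\<close>.  The \<open>\<delta> j\<close> sum to \<open>n + 1\<close> and the \<open>\<delta>t j\<close> to
  \<open>k + 1\<close>, and the product is therefore at most \<open>2 powr (- (n - k) / 2)\<close> (\<open>prod_norm_ratio_le\<close>).  The same chord,
  used once more with \<open>n + 1 \<le> m \<le> 2 (k + 1)\<close>, shows that this is below the bound of the theorem
  (\<open>two_powr_le_bound\<close>).  The factor with the regular simplex comes from the same cone integral: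
  for a regular simplex with inscribed unit ball the normals of the lifted cone form an orthonormal
  basis of \<open>F\<close>, the cone is an orthant and the integral is \<open>1\<close> (\<open>measure_regular_simplex_ge\<close>).

  The Brascamp-Lieb inequality is proved by transport of mass, following Barthe.  A map \<open>T\<close> takes
  the exponential distribution to the normal one, and \<open>\<Theta> y = (\<Sum>j. c j T (a j (u j \<bullet> y)) u j)\<close> is an
  injective map of the open cone.  By Ball's determinant inequality
  (\<open>det_identity_decomposition_ge\<close>) its Jacobian determinant dominates the product of the one
  dimensional derivatives to the powers \<open>c j\<close>, and by \<open>norm_sum_identity_decomposition_le\<close> the
  Gaussian density at \<open>\<Theta> y\<close> dominates the product of the one dimensional densities.  Hence the
  product of exponentials is, up to its normalising constant, at most the pull-back of the Gaussian
  density, whose integral is at most \<open>1\<close>.\<close>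

section \<open>Decompositions of the identity\<close>

definition identity_decomposition ::
    "'a::euclidean_space set \<Rightarrow> 'j set \<Rightarrow> ('j \<Rightarrow> real) \<Rightarrow> ('j \<Rightarrow> 'a) \<Rightarrow> bool" where
  "identity_decomposition V J c u \<longleftrightarrow>
     finite J \<and> (\<forall>j\<in>J. 0 < c j \<and> u j \<in> V \<and> norm (u j) = 1) \<and>
     (\<forall>x\<in>V. (\<Sum>j\<in>J. (c j * (u j \<bullet> x)) *\<^sub>R u j) = x)"

lemma identity_decomposition_cong:
  assumes "identity_decomposition V J c u" "\<And>j. j \<in> J \<Longrightarrow> c j = c' j" "\<And>j. j \<in> J \<Longrightarrow> u j = u' j"
  shows "identity_decomposition V J c' u'"
  using assms unfolding identity_decomposition_def by (auto cong: sum.cong)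

lemma identity_decomposition_inner:
  assumes "identity_decomposition V J c u" "x \<in> V"
  shows "(\<Sum>j\<in>J. c j * (u j \<bullet> x) * (u j \<bullet> y)) = x \<bullet> y"
proof -
  have "(\<Sum>j\<in>J. (c j * (u j \<bullet> x)) *\<^sub>R u j) \<bullet> y = x \<bullet> y"
    using assms by (simp add: identity_decomposition_def)
  then show ?thesis by (simp add: inner_sum_left)
qed

text \<open>Both sides are the trace of the identity of \<open>V\<close>.\<close>

lemma identity_decomposition_sum_weights:
  assumes dec: "identity_decomposition V J c u" and V: "subspace V"
  shows "(\<Sum>j\<in>J. c j) = dim V"
proof -
  obtain B where B: "onb V B" using onb_exists[OF V] by blast
  have BV: "b \<in> V" "norm b = 1" if "b \<in> B" for b using B that by (auto simp: onb_def)
  have par: "(\<Sum>b\<in>B. (u j \<bullet> b)\<^sup>2) = 1" if j: "j \<in> J" for j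
  proof -
    have uj: "u j \<in> V" "norm (u j) = 1" using dec j by (auto simp: identity_decomposition_def)
    have "norm (\<Sum>b\<in>B. (u j \<bullet> b) *\<^sub>R b) = 1"
      using onb_expand[OF B uj(1)] uj(2) by simp
    then show ?thesis by (simp add: onb_norm[OF B])
  qed
  have "(\<Sum>j\<in>J. c j) = (\<Sum>j\<in>J. \<Sum>b\<in>B. c j * (u j \<bullet> b)\<^sup>2)"
    by (simp add: sum_distrib_left[symmetric] par)
  also have "\<dots> = (\<Sum>b\<in>B. \<Sum>j\<in>J. c j * (u j \<bullet> b) * (u j \<bullet> b))"
    by (subst sum.swap) (simp add: power2_eq_square mult.assoc)
  also have "\<dots> = (\<Sum>b\<in>B. 1)"
    using BV by (intro sum.cong refl) (simp add: identity_decomposition_inner[OF dec] dot_square_norm)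
  finally show ?thesis using onb_card[OF B] by simp
qed

text \<open>Test the decomposition on \<open>u j\<close>: the term of index \<open>j\<close> alone contributes \<open>c j\<close> to
  \<open>u j \<bullet> u j = 1\<close>.\<close>

lemma identity_decomposition_weight_le_1:
  assumes dec: "identity_decomposition V J c u" and j: "j \<in> J"
  shows "c j \<le> 1"
proof -
  have fin: "finite J" and u: "u j \<in> V" "u j \<bullet> u j = 1" and c: "\<And>i. i \<in> J \<Longrightarrow> 0 < c i"
    using dec j by (auto simp: identity_decomposition_def dot_square_norm)
  have "c j * (u j \<bullet> u j) * (u j \<bullet> u j) \<le> (\<Sum>i\<in>J. c i * (u i \<bullet> u j) * (u i \<bullet> u j))"
  proof (rule member_le_sum[OF j _ fin])
    fix i assume "i \<in> J - {j}"
    then show "0 \<le> c i * (u i \<bullet> u j) * (u i \<bullet> u j)"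
      using c[of i] by (simp add: mult.assoc)
  qed
  then show ?thesis using identity_decomposition_inner[OF dec u(1), of "u j"] u(2) by simp
qed

text \<open>With \<open>z\<close> the vector on the left, expand
  \<open>0 \<le> (\<Sum>j\<in>J. c j * (s j - u j \<bullet> z)\<^sup>2)\<close>; both the mixed sum and the last square sum are
  \<open>z \<bullet> z\<close>.\<close>

lemma norm_sum_identity_decomposition_le:
  assumes dec: "identity_decomposition V J c u" and V: "subspace V"
  shows "(norm (\<Sum>j\<in>J. (c j * s j) *\<^sub>R u j))\<^sup>2 \<le> (\<Sum>j\<in>J. c j * (s j)\<^sup>2)"
proof -
  define z where "z = (\<Sum>j\<in>J. (c j * s j) *\<^sub>R u j)"
  have c: "0 \<le> c j" if "j \<in> J" for j using dec that by (auto simp: identity_decomposition_def less_imp_le)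
  have z: "z \<in> V"
    unfolding z_def using dec V
    by (intro subspace_sum subspace_scale) (auto simp: identity_decomposition_def)
  have zz: "(\<Sum>j\<in>J. c j * s j * (u j \<bullet> z)) = z \<bullet> z"
    by (simp add: z_def inner_sum_left)
  have "0 \<le> (\<Sum>j\<in>J. c j * (s j - u j \<bullet> z)\<^sup>2)"
    using c by (intro sum_nonneg) simp
  also have "\<dots> = (\<Sum>j\<in>J. c j * (s j)\<^sup>2) - 2 * (\<Sum>j\<in>J. c j * s j * (u j \<bullet> z))
      + (\<Sum>j\<in>J. c j * (u j \<bullet> z) * (u j \<bullet> z))"
    by (simp add: power2_eq_square algebra_simps sum.distrib sum_subtractf sum_distrib_left)
  also have "\<dots> = (\<Sum>j\<in>J. c j * (s j)\<^sup>2) - z \<bullet> z"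
    by (simp add: zz identity_decomposition_inner[OF dec z])
  finally show ?thesis by (simp add: z_def dot_square_norm)
qed

text \<open>Monotone functions of the coordinates \<open>u j \<bullet> y\<close> combine to a strictly monotone map.\<close>

lemma inj_on_weighted_sum:
  assumes dec: "identity_decomposition V J c u" and V: "subspace V"
    and mono: "\<And>j s t. \<lbrakk>j \<in> J; 0 < s; s < t\<rbrakk> \<Longrightarrow> f j s < (f j t :: real)"
  shows "inj_on (\<lambda>y. \<Sum>j\<in>J. (c j * f j (u j \<bullet> y)) *\<^sub>R u j) {y \<in> V. \<forall>j\<in>J. 0 < u j \<bullet> y}"
proof (rule inj_onI)
  fix x y
  assume x: "x \<in> {y \<in> V. \<forall>j\<in>J. 0 < u j \<bullet> y}" and y: "y \<in> {y \<in> V. \<forall>j\<in>J. 0 < u j \<bullet> y}"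
    and eq: "(\<Sum>j\<in>J. (c j * f j (u j \<bullet> x)) *\<^sub>R u j) = (\<Sum>j\<in>J. (c j * f j (u j \<bullet> y)) *\<^sub>R u j)"
  have fin: "finite J" and c: "\<And>j. j \<in> J \<Longrightarrow> 0 < c j"
    using dec by (auto simp: identity_decomposition_def)
  let ?\<phi> = "\<lambda>j. (f j (u j \<bullet> x) - f j (u j \<bullet> y)) * (u j \<bullet> x - u j \<bullet> y)"
  have pos: "0 \<le> ?\<phi> j" "?\<phi> j = 0 \<longleftrightarrow> u j \<bullet> x = u j \<bullet> y" if j: "j \<in> J" for j
  proof -
    have "0 < u j \<bullet> x" "0 < u j \<bullet> y" using x y j by auto
    then show "0 \<le> ?\<phi> j" "?\<phi> j = 0 \<longleftrightarrow> u j \<bullet> x = u j \<bullet> y"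
      using mono[OF j, of "u j \<bullet> x" "u j \<bullet> y"] mono[OF j, of "u j \<bullet> y" "u j \<bullet> x"]
      by (cases "u j \<bullet> x" "u j \<bullet> y" rule: linorder_cases; simp add: mult_nonneg_nonneg mult_nonpos_nonpos less_imp_le)+
  qed
  \<comment> \<open>Equal images make \<open>(\<Theta> x - \<Theta> y) \<bullet> (x - y)\<close> vanish, where \<open>\<Theta>\<close> is the weighted sum; this is a sum of nonnegative terms.\<close>
  have "(\<Sum>j\<in>J. c j * ?\<phi> j)
      = ((\<Sum>j\<in>J. (c j * f j (u j \<bullet> x)) *\<^sub>R u j) - (\<Sum>j\<in>J. (c j * f j (u j \<bullet> y)) *\<^sub>R u j)) \<bullet> (x - y)"
    by (simp add: inner_sum_left inner_diff_left inner_diff_right sum_subtractf[symmetric] algebra_simps)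
  also have "\<dots> = 0" using eq by simp
  finally have "\<forall>j\<in>J. c j * ?\<phi> j = 0"
    using sum_nonneg_eq_0_iff[OF fin, of "\<lambda>j. c j * ?\<phi> j"] mult_nonneg_nonneg[OF less_imp_le[OF c] pos(1)]
    by blast
  then have same: "u j \<bullet> (x - y) = 0" if "j \<in> J" for j
    using c pos(2) that by (force simp: inner_diff_right)
  have "x - y \<in> V" using x y V by (auto intro: subspace_diff)
  then have "x - y = (\<Sum>j\<in>J. (c j * (u j \<bullet> (x - y))) *\<^sub>R u j)"
    using dec by (simp add: identity_decomposition_def)
  also have "\<dots> = 0" by (simp add: same)
  finally show "x = y" by simp
qed

lemma orth_proj:
  fixes F :: "'a::euclidean_space set"
  assumes F: "subspace F"
  shows "orth_proj F x \<in> F" and "z \<in> F \<Longrightarrow> orth_proj F x \<bullet> z = x \<bullet> z"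
proof -
  obtain y w where y: "y \<in> span F" and w: "\<And>z. z \<in> span F \<Longrightarrow> orthogonal w z" and x: "x = y + w"
    using orthogonal_subspace_decomp_exists[of F x] by metis
  have y': "y \<in> F \<and> (\<forall>z\<in>F. orthogonal (x - y) z)"
    using y w x F by (simp add: span_eq_iff[THEN iffD2])
  have uniq: "y' = y" if "y' \<in> F \<and> (\<forall>z\<in>F. orthogonal (x - y') z)" for y'
  proof -
    have "y' - y \<in> F" using that y' F by (intro subspace_diff) auto
    then have "(x - y) \<bullet> (y' - y) - (x - y') \<bullet> (y' - y) = 0"
      using that y' by (auto simp: orthogonal_def)
    then have "(y' - y) \<bullet> (y' - y) = 0" by (simp add: inner_diff_left)
    then show ?thesis by simp
  qed
  have "orth_proj F x = y"
    unfolding orth_proj_def using y' uniq by (rule the_equality)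
  then show "orth_proj F x \<in> F" "z \<in> F \<Longrightarrow> orth_proj F x \<bullet> z = x \<bullet> z"
    using y' by (auto simp: orthogonal_def inner_diff_left)
qed

lemma norm_orth_proj_le:
  fixes F :: "'a::euclidean_space set"
  assumes "subspace F"
  shows "norm (orth_proj F x) \<le> norm x"
proof -
  let ?w = "orth_proj F x"
  have "norm ?w * norm ?w = ?w \<bullet> ?w" by (simp add: dot_square_norm power2_eq_square)
  also have "\<dots> = x \<bullet> ?w" by (rule orth_proj(2)[OF assms orth_proj(1)[OF assms]])
  also have "\<dots> \<le> norm x * norm ?w" by (rule norm_cauchy_schwarz)
  finally have "norm ?w * norm ?w \<le> norm x * norm ?w" .
  then show ?thesis
    by (cases "?w = 0") (simp_all add: mult_le_cancel_right)
qed

text \<open>Projecting to \<open>F\<close> preserves the identity of quadratic forms on \<open>F\<close>; the weights absorb the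
  squared lengths of the projections.\<close>

lemma identity_decomposition_orth_proj:
  fixes u :: "'j \<Rightarrow> 'a::euclidean_space"
  assumes dec: "identity_decomposition UNIV J c u" and F: "subspace F"
    and nz: "\<And>j. j \<in> J \<Longrightarrow> orth_proj F (u j) \<noteq> 0"
  shows "identity_decomposition F J (\<lambda>j. c j * (norm (orth_proj F (u j)))\<^sup>2)
    (\<lambda>j. orth_proj F (u j) /\<^sub>R norm (orth_proj F (u j)))"
  unfolding identity_decomposition_def
proof (intro conjI ballI)
  let ?w = "\<lambda>j. orth_proj F (u j)"
  show "finite J" using dec by (simp add: identity_decomposition_def)
  fix x assume x: "x \<in> F"
  define y where "y = (\<Sum>j\<in>J. (c j * (?w j \<bullet> x)) *\<^sub>R ?w j) - x"
  have yF: "y \<in> F"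
    unfolding y_def using F x orth_proj(1)[OF F] by (intro subspace_diff subspace_sum subspace_scale) auto
  have "y \<bullet> y = (\<Sum>j\<in>J. c j * (u j \<bullet> x) * (u j \<bullet> y)) - x \<bullet> y"
    by (subst (1) y_def) (simp add: inner_diff_left inner_sum_left orth_proj(2)[OF F] x yF)
  also have "\<dots> = 0" using identity_decomposition_inner[OF dec, of x y] by simp
  finally have "(\<Sum>j\<in>J. (c j * (?w j \<bullet> x)) *\<^sub>R ?w j) = x" by (simp add: y_def)
  moreover have "(\<Sum>j\<in>J. (c j * (norm (?w j))\<^sup>2 * ((?w j /\<^sub>R norm (?w j)) \<bullet> x)) *\<^sub>R (?w j /\<^sub>R norm (?w j)))
      = (\<Sum>j\<in>J. (c j * (?w j \<bullet> x)) *\<^sub>R ?w j)"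
  proof (intro sum.cong refl)
    fix j assume "j \<in> J"
    then have "(norm (?w j))\<^sup>2 * (inverse (norm (?w j)) * inverse (norm (?w j))) = 1"
      using nz by (simp add: power2_eq_square field_simps)
    moreover have "(c j * (norm (?w j))\<^sup>2 * ((?w j /\<^sub>R norm (?w j)) \<bullet> x)) *\<^sub>R (?w j /\<^sub>R norm (?w j))
        = (c j * (?w j \<bullet> x) * ((norm (?w j))\<^sup>2 * (inverse (norm (?w j)) * inverse (norm (?w j))))) *\<^sub>R ?w j"
      by (simp add: mult_ac)
    ultimately show "(c j * (norm (?w j))\<^sup>2 * ((?w j /\<^sub>R norm (?w j)) \<bullet> x)) *\<^sub>R (?w j /\<^sub>R norm (?w j))
        = (c j * (?w j \<bullet> x)) *\<^sub>R ?w j"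
      by (simp only: mult_1_right)
  qed
  ultimately show "(\<Sum>j\<in>J. (c j * (norm (?w j))\<^sup>2 * ((?w j /\<^sub>R norm (?w j)) \<bullet> x)) *\<^sub>R (?w j /\<^sub>R norm (?w j))) = x"
    by simp
qed (use nz dec F in \<open>auto simp: identity_decomposition_def intro: subspace_scale orth_proj(1)\<close>)

section \<open>The spectral theorem and Ball's determinant inequality\<close>

text \<open>A maximiser of the Rayleigh quotient on the unit sphere of \<open>V\<close> is an eigenvector, and its
  orthogonal complement in \<open>V\<close> is again invariant.\<close>

lemma self_adjoint_eigenbasis:
  fixes f :: "'a::euclidean_space \<Rightarrow> 'a"
  assumes lin: "linear f" and adj: "\<And>x y. f x \<bullet> y = x \<bullet> f y"
    and V: "subspace V" "f ` V \<subseteq> V"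
  shows "\<exists>B. onb V B \<and> (\<forall>b\<in>B. f b = (f b \<bullet> b) *\<^sub>R b)"
  using V
proof (induction "dim V" arbitrary: V rule: less_induct)
  case less
  show ?case
  proof (cases "V = {0}")
    case True
    then show ?thesis
      by (intro exI[of _ "{}"]) (auto simp: onb_def)
  next
    case False
    interpret f: linear f by (rule lin)
    obtain w where w: "w \<in> V" "w \<noteq> 0"
      using False less.prems(1) subspace_0 by blast
    have ne: "sphere 0 1 \<inter> V \<noteq> {}"
    proof -
      have "(1 / norm w) *\<^sub>R w \<in> sphere 0 1 \<inter> V"
        using w subspace_scale[OF less.prems(1) w(1), of "1 / norm w"] by simp
      then show ?thesis by blast
    qed
    have cpt: "compact (sphere (0::'a) 1 \<inter> V)"
      by (intro compact_Int_closed compact_sphere closed_subspace less.prems(1))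
    have cont: "continuous_on (sphere 0 1 \<inter> V) (\<lambda>x. f x \<bullet> x)"
      by (intro continuous_on_inner linear_continuous_on continuous_on_id)
        (use lin linear_conv_bounded_linear in blast)
    obtain e where e: "e \<in> sphere 0 1 \<inter> V"
      and max: "\<And>x. x \<in> sphere 0 1 \<inter> V \<Longrightarrow> f x \<bullet> x \<le> f e \<bullet> e"
      using continuous_attains_sup[OF cpt ne cont] by blast
    have ee: "e \<bullet> e = 1" using e by (simp add: dot_square_norm)
    define l where "l = f e \<bullet> e"
    have bound: "f x \<bullet> x \<le> l * (x \<bullet> x)" if "x \<in> V" for x
    proof (cases "x = 0")
      case True then show ?thesis by (simp add: f.zero)
    next
      case False
      have "(1 / norm x) *\<^sub>R x \<in> sphere 0 1 \<inter> V"
        using False subspace_scale[OF less.prems(1) that, of "1 / norm x"] by simp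
      from max[OF this] have "(f x \<bullet> x) / (norm x)\<^sup>2 \<le> l"
        by (simp add: f.scaleR l_def power2_eq_square divide_inverse mult_ac)
      then show ?thesis
        using False by (simp add: divide_le_eq dot_square_norm)
    qed
    \<comment> \<open>The form \<open>l (x \<bullet> x) - f x \<bullet> x\<close> is nonnegative on \<open>V\<close> and vanishes at \<open>e\<close>, so its derivative at \<open>e\<close> in the direction \<open>d\<close>, which is \<open>2 (d \<bullet> d)\<close>, must vanish.\<close>
    define d where "d = l *\<^sub>R e - f e"
    have d: "d \<in> V"
      unfolding d_def using e less.prems
      by (intro subspace_diff subspace_scale) auto
    have "0 \<le> 2 * t * (d \<bullet> d) + t\<^sup>2 * (l * (d \<bullet> d) - f d \<bullet> d)" for t
    proof -
      have "e + t *\<^sub>R d \<in> V"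
        using e d less.prems(1) by (intro subspace_add subspace_scale) auto
      from bound[OF this] have "0 \<le> l * ((e + t *\<^sub>R d) \<bullet> (e + t *\<^sub>R d)) - f (e + t *\<^sub>R d) \<bullet> (e + t *\<^sub>R d)"
        by simp
      also have "\<dots> = (l * (e \<bullet> e) - l) + 2 * t * (l * (e \<bullet> d) - f e \<bullet> d) + t\<^sup>2 * (l * (d \<bullet> d) - f d \<bullet> d)"
        using adj[of d e] by (simp add: f.add f.scaleR inner_add_left inner_add_right l_def
            algebra_simps power2_eq_square inner_commute)
      also have "l * (e \<bullet> d) - f e \<bullet> d = d \<bullet> d"
        by (simp add: d_def inner_diff_left)
      finally show ?thesis by (simp add: ee)
    qed note quad = this
    have "d \<bullet> d = 0"
    proof (rule ccontr)
      assume nz: "d \<bullet> d \<noteq> 0"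
      define p where "p = d \<bullet> d"
      \<comment> \<open>A step of length \<open>p / q\<close> against \<open>d\<close>, with \<open>q\<close> above the second order coefficient, would make the form negative.\<close>
      define q where "q = \<bar>l * p - f d \<bullet> d\<bar> + 1"
      have pq: "p > 0" "q > 0" using nz by (auto simp: p_def q_def)
      have "0 \<le> 2 * (- p / q) * p + (- p / q)\<^sup>2 * (l * p - f d \<bullet> d)"
        using quad[of "- p / q"] by (simp add: p_def)
      also have "\<dots> \<le> 2 * (- p / q) * p + (- p / q)\<^sup>2 * q"
        by (intro add_left_mono mult_left_mono) (auto simp: q_def)
      also have "\<dots> = - (p\<^sup>2 / q)"
        using pq by (simp add: power2_eq_square field_simps)
      also have "\<dots> < 0" using pq by simp
      finally show False by simp
    qed
    then have fe: "f e = l *\<^sub>R e" by (simp add: d_def)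
    define W where "W = {x \<in> V. e \<bullet> x = 0}"
    have W: "subspace W"
    proof -
      have "W = V \<inter> {x. e \<bullet> x = 0}" by (auto simp: W_def)
      then show ?thesis using less.prems(1) by (simp add: subspace_inter subspace_hyperplane)
    qed
    have fW: "f ` W \<subseteq> W"
      using less.prems(2) adj[of e] fe by (auto simp: W_def) (metis inner_scaleR_left mult_zero_right)
    have "e \<notin> W" using ee by (simp add: W_def)
    then have "W \<subset> V" using e W_def by blast
    then have "dim W < dim V"
      using W less.prems(1) by (metis dim_psubset span_eq_iff)
    from less.hyps[OF this W fW] obtain B
      where B: "onb W B" "\<forall>b\<in>B. f b = (f b \<bullet> b) *\<^sub>R b" by blast
    have BW: "B \<subseteq> W" using B(1) by (simp add: onb_def)
    have eB: "orthogonal e b" "orthogonal b e" if "b \<in> B" for b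
      using that BW by (auto simp: W_def orthogonal_def inner_commute)
    have "V \<subseteq> span (insert e B)"
    proof
      fix x assume x: "x \<in> V"
      have "x - (e \<bullet> x) *\<^sub>R e \<in> W"
        using x e ee less.prems(1) by (auto simp: W_def inner_diff_right intro: subspace_diff subspace_scale)
      then have "x - (e \<bullet> x) *\<^sub>R e \<in> span B" using B(1) by (simp add: onb_def)
      then show "x \<in> span (insert e B)" by (auto simp: span_insert)
    qed
    moreover have "insert e B \<subseteq> V" using e BW by (auto simp: W_def)
    ultimately have "span (insert e B) = V"
      using less.prems(1) by (simp add: span_minimal subset_antisym)
    then have "onb V (insert e B)"
      using B(1) e eB \<open>insert e B \<subseteq> V\<close> by (auto simp: onb_def pairwise_insert)
    then show ?thesis
      using B(2) fe ee by (intro exI[of _ "insert e B"]) auto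
  qed
qed

lemma det_matrix_eigenbasis:
  fixes f :: "real^'d \<Rightarrow> real^'d"
  assumes lin: "linear f" and B: "onb UNIV B" and eig: "\<And>b. b \<in> B \<Longrightarrow> f b = l b *\<^sub>R b"
  shows "det (matrix f) = (\<Prod>b\<in>B. l b)"
proof -
  have "card B = CARD('d)" using onb_card[OF B] by simp
  then obtain \<beta> :: "'d \<Rightarrow> real^'d" where \<beta>: "bij_betw \<beta> UNIV B"
    using finite_same_card_bij[of "UNIV::'d set" B] onb_finite[OF B] by auto
  have mem: "\<beta> i \<in> B" for i using \<beta> by (auto simp: bij_betw_def)
  have inj: "\<beta> i = \<beta> j \<longleftrightarrow> i = j" for i j using \<beta> by (auto simp: bij_betw_def inj_on_def)
  have inn: "\<beta> i \<bullet> \<beta> j = (if i = j then 1 else 0)" for i j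
    using onb_inner[OF B mem mem] inj by simp
  \<comment> \<open>The rows of \<open>R\<close> are the eigenvectors, so \<open>R\<close> is orthogonal and conjugates \<open>f\<close> to a diagonal matrix.\<close>
  define R :: "real^'d^'d" where "R = (\<chi> i. \<beta> i)"
  have RR: "R ** transpose R = mat 1"
    using inn by (simp add: vec_eq_iff mat_def R_def transpose_def matrix_matrix_mult_def inner_vec_def)
  have diag: "(R ** matrix f ** transpose R) $ i $ j = (if i = j then l (\<beta> i) else 0)" for i j
  proof -
    have "(R ** matrix f ** transpose R) $ i $ j = ((R ** matrix f ** transpose R) *v axis j 1) $ i"
      by (simp add: matrix_vector_mult_basis column_def)
    also have "\<dots> = (R *v (matrix f *v (transpose R *v axis j 1))) $ i"
      by (simp only: matrix_vector_mul_assoc matrix_mul_assoc)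
    also have "transpose R *v axis j 1 = \<beta> j"
      by (simp add: matrix_vector_mult_basis column_def transpose_def R_def vec_eq_iff)
    also have "matrix f *v \<beta> j = l (\<beta> j) *\<^sub>R \<beta> j"
      using lin by (simp add: matrix_works eig mem)
    also have "(R *v (l (\<beta> j) *\<^sub>R \<beta> j)) $ i = (if i = j then l (\<beta> i) else 0)"
      by (simp add: matrix_vector_mul_component R_def inn)
    finally show ?thesis .
  qed
  have "det R * det R = 1"
    using arg_cong[OF RR, of det] by (simp add: det_mul)
  then have "det (matrix f) = det (R ** matrix f ** transpose R)"
    by (simp add: det_mul)
  also have "\<dots> = (\<Prod>i\<in>UNIV. l (\<beta> i))"
    by (subst det_diagonal) (auto simp: diag)
  also have "\<dots> = (\<Prod>b\<in>B. l b)" by (rule prod.reindex_bij_betw[OF \<beta>])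
  finally show ?thesis .
qed

text \<open>Jensen's inequality for \<open>ln\<close>, from the tangent bound \<open>ln x \<le> x - 1\<close> at \<open>x = t j / s\<close> with \<open>s\<close>
  the weighted mean.\<close>

lemma weighted_arith_geom_mean_ln:
  fixes w t :: "'j \<Rightarrow> real"
  assumes "finite J" "\<And>j. j \<in> J \<Longrightarrow> w j \<ge> 0" "\<And>j. j \<in> J \<Longrightarrow> t j > 0" "(\<Sum>j\<in>J. w j) = 1"
  shows "0 < (\<Sum>j\<in>J. w j * t j)" and "(\<Sum>j\<in>J. w j * ln (t j)) \<le> ln (\<Sum>j\<in>J. w j * t j)"
proof -
  define s where "s = (\<Sum>j\<in>J. w j * t j)"
  obtain i where i: "i \<in> J" "w i \<noteq> 0"
    using assms(4) by (metis sum.neutral zero_neq_one)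
  then have "0 < w i * t i" using assms(2)[of i] assms(3)[of i] by simp
  also have "\<dots> \<le> s"
    unfolding s_def using assms(1-3) i(1) by (intro member_le_sum) (auto intro: mult_nonneg_nonneg less_imp_le)
  finally show s: "0 < (\<Sum>j\<in>J. w j * t j)" by (simp add: s_def)
  have "(\<Sum>j\<in>J. w j * ln (t j)) - ln s = (\<Sum>j\<in>J. w j * ln (t j / s))"
  proof -
    have "(\<Sum>j\<in>J. w j * ln (t j / s)) = (\<Sum>j\<in>J. w j * ln (t j) - w j * ln s)"
    proof (intro sum.cong refl)
      fix j assume "j \<in> J"
      then have "t j \<noteq> 0" using assms(3)[of j] by simp
      then show "w j * ln (t j / s) = w j * ln (t j) - w j * ln s"
        using s by (simp add: s_def[symmetric] ln_div right_diff_distrib)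
    qed
    then show ?thesis using assms(4) by (simp add: sum_subtractf sum_distrib_right[symmetric])
  qed
  also have "\<dots> \<le> (\<Sum>j\<in>J. w j * (t j / s - 1))"
    using assms(2,3) s by (intro sum_mono mult_left_mono ln_le_minus_one) (auto simp: s_def)
  also have "\<dots> = (\<Sum>j\<in>J. w j * t j) / s - (\<Sum>j\<in>J. w j)"
    by (simp add: right_diff_distrib sum_subtractf sum_divide_distrib)
  also have "\<dots> = 0" using s assms(4) by (simp add: s_def)
  finally show "(\<Sum>j\<in>J. w j * ln (t j)) \<le> ln (\<Sum>j\<in>J. w j * t j)" by (simp add: s_def)
qed

text \<open>In an eigenbasis of the matrix, each eigenvalue is a mean of the \<open>t j\<close> with weights
  \<open>c j (u j \<bullet> b)\<^sup>2\<close>.  Concavity of \<open>ln\<close> bounds its logarithm below, and summing over the basis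
  turns the weights into \<open>c j * norm (u j)^2 = c j\<close>.\<close>

lemma det_identity_decomposition_ge:
  fixes u :: "'j \<Rightarrow> real^'d"
  assumes dec: "identity_decomposition UNIV J c u" and t: "\<And>j. j \<in> J \<Longrightarrow> 0 < t j"
  shows "(\<Prod>j\<in>J. t j powr c j) \<le> det (matrix (\<lambda>x. \<Sum>j\<in>J. (c j * t j * (u j \<bullet> x)) *\<^sub>R u j))"
proof -
  let ?A = "\<lambda>x. \<Sum>j\<in>J. (c j * t j * (u j \<bullet> x)) *\<^sub>R u j"
  have fin: "finite J" and c: "\<And>j. j \<in> J \<Longrightarrow> 0 < c j" and u1: "\<And>j. j \<in> J \<Longrightarrow> norm (u j) = 1"
    using dec by (auto simp: identity_decomposition_def)
  have lin: "linear ?A"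
    by (intro linearI) (simp_all add: inner_add_right algebra_simps sum.distrib scaleR_sum_right)
  have adj: "?A x \<bullet> y = x \<bullet> ?A y" for x y
    by (simp add: inner_sum_left inner_sum_right inner_commute mult_ac)
  obtain B where B: "onb UNIV B" and eig: "\<forall>b\<in>B. ?A b = (?A b \<bullet> b) *\<^sub>R b"
    using self_adjoint_eigenbasis[OF lin adj, of UNIV] by auto
  have det: "det (matrix ?A) = (\<Prod>b\<in>B. ?A b \<bullet> b)"
    by (rule det_matrix_eigenbasis[OF lin B]) (use eig in blast)
  have Ab: "?A b \<bullet> b = (\<Sum>j\<in>J. (c j * (u j \<bullet> b)\<^sup>2) * t j)" for b
    by (simp add: inner_sum_left power2_eq_square mult_ac)
  \<comment> \<open>At a unit eigenvector \<open>b\<close> the numbers \<open>c j (u j \<bullet> b)\<^sup>2\<close> sum to \<open>1\<close>, so the eigenvalue is a weighted mean of the \<open>t j\<close>.\<close>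
  have w1: "(\<Sum>j\<in>J. c j * (u j \<bullet> b)\<^sup>2) = 1" if "b \<in> B" for b
    using identity_decomposition_inner[OF dec, of b b] B that
    by (simp add: onb_def dot_square_norm power2_eq_square mult.assoc)
  have pos: "0 < ?A b \<bullet> b" and jensen: "(\<Sum>j\<in>J. c j * (u j \<bullet> b)\<^sup>2 * ln (t j)) \<le> ln (?A b \<bullet> b)"
    if "b \<in> B" for b
    unfolding Ab using weighted_arith_geom_mean_ln[OF fin _ t w1[OF that]] c by (simp_all add: less_imp_le)
  have par: "(\<Sum>b\<in>B. (u j \<bullet> b)\<^sup>2) = 1" if "j \<in> J" for j
    using onb_expand[OF B, of "u j"] onb_norm[OF B, of "\<lambda>b. u j \<bullet> b"] u1[OF that] by simp
  have "(\<Prod>j\<in>J. t j powr c j) = exp (\<Sum>j\<in>J. c j * ln (t j))"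
    using t fin by (simp add: exp_sum powr_def less_imp_neq[symmetric] cong: prod.cong)
  also have "(\<Sum>j\<in>J. c j * ln (t j)) = (\<Sum>j\<in>J. \<Sum>b\<in>B. c j * (u j \<bullet> b)\<^sup>2 * ln (t j))"
    by (simp add: sum_distrib_left[symmetric] sum_distrib_right[symmetric] par)
  also have "\<dots> = (\<Sum>b\<in>B. \<Sum>j\<in>J. c j * (u j \<bullet> b)\<^sup>2 * ln (t j))"
    by (rule sum.swap)
  also have "exp \<dots> \<le> exp (\<Sum>b\<in>B. ln (?A b \<bullet> b))"
    using jensen by (simp add: sum_mono)
  also have "\<dots> = (\<Prod>b\<in>B. ?A b \<bullet> b)"
    using pos onb_finite[OF B] by (simp add: exp_sum)
  finally show ?thesis using det by simp
qed

section \<open>Transport of the exponential to the normal distribution\<close>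

text \<open>\<open>T\<close> is the composition of the exponential distribution function with the inverse of the normal
  one.  The equation for its derivative \<open>D\<close> is the change of variables for densities.\<close>

lemma exponential_to_normal_transport:
  "\<exists>T D. \<forall>t>0. (T has_real_derivative D t) (at t) \<and> 0 < D t \<and>
     D t * std_normal_density (T t) = exp (- t)"
proof -
  let ?M = "density lborel std_normal_density"
  let ?g = "std_normal_density"
  interpret M: prob_space ?M by (rule prob_space_normal_density) simp
  interpret M: real_distribution ?M by unfold_locales simp_all
  define \<Phi> where "\<Phi> = cdf ?M"
  have cont: "continuous_on A ?g" for A
    unfolding normal_density_def by (intro continuous_intros) auto
  have gpos: "0 < ?g x" for x by (simp add: normal_density_pos)
  \<comment> \<open>The normal distribution function has the normal density as its derivative, by the fundamental theorem of calculus on compact intervals.\<close>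
  have diff: "\<Phi> x - \<Phi> a = integral {a..x} ?g" if "a < x" for a x
  proof -
    have hi: "(?g has_integral integral {a..x} ?g) {a..x}"
      by (intro integrable_integral integrable_continuous_real cont)
    have "emeasure ?M {a<..x} = emeasure ?M {a..x}"
    proof -
      have "emeasure ?M {a<..x} = (\<integral>\<^sup>+y. ?g y * indicator {a<..x} y \<partial>lborel)"
        by (subst emeasure_density) (auto simp: ennreal_indicator ennreal_mult)
      also have "\<dots> = (\<integral>\<^sup>+y. ?g y * indicator {a..x} y \<partial>lborel)"
        using AE_lborel_singleton[of a] by (intro nn_integral_cong_AE) (auto split: split_indicator elim!: eventually_mono)
      also have "\<dots> = emeasure ?M {a..x}"
        by (subst emeasure_density) (auto simp: ennreal_indicator ennreal_mult)
      finally show ?thesis .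
    qed
    also have "\<dots> = (\<integral>\<^sup>+y. indicator {a..x} y * ?g y \<partial>lborel)"
      by (subst emeasure_density) (auto simp: ennreal_indicator ennreal_mult mult.commute)
    also have "\<dots> = integral {a..x} ?g"
      by (rule nn_integral_has_integral_lebesgue[OF _ hi]) simp
    finally have "measure ?M {a<..x} = integral {a..x} ?g"
      by (simp add: measure_def integral_nonneg integrable_continuous_real cont)
    then show ?thesis
      using M.cdf_diff_eq[OF that] by (simp add: \<Phi>_def)
  qed
  have der: "(\<Phi> has_real_derivative ?g x) (at x)" for x
  proof -
    have "((\<lambda>u. integral {x - 1..u} ?g) has_real_derivative ?g x) (at x within {x - 1..x + 1})"
      by (rule integral_has_real_derivative[OF cont]) auto
    then have "((\<lambda>u. \<Phi> (x - 1) + integral {x - 1..u} ?g) has_real_derivative ?g x) (at x)"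
      by (auto intro!: derivative_eq_intros simp: at_within_Icc_at)
    then show ?thesis
      by (rule has_field_derivative_transform_within_open[where S = "{x - 1<..<x + 1}"])
        (auto simp: diff[symmetric])
  qed
  have mono: "\<Phi> x < \<Phi> y" if "x < y" for x y
    using DERIV_pos_imp_increasing[OF that, of \<Phi>] der gpos by blast
  have contPhi: "isCont \<Phi> x" for x using der DERIV_isCont by blast
  have ex: "\<exists>x. \<Phi> x = p" if "0 < p" "p < 1" for p
  proof -
    have "eventually (\<lambda>x. \<Phi> x < p) at_bot"
      using order_tendstoD(2)[OF M.cdf_lim_at_bot that(1)] by (simp add: \<Phi>_def)
    then obtain a where a: "\<Phi> a < p" by (auto simp: eventually_at_bot_linorder)
    have "eventually (\<lambda>x. p < \<Phi> x) at_top"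
      using order_tendstoD(1)[OF M.cdf_lim_at_top_prob that(2)] by (simp add: \<Phi>_def)
    then obtain b where b: "p < \<Phi> b" by (auto simp: eventually_at_top_linorder)
    have "a \<le> b" using a b mono[of b a] by (cases "a \<le> b") auto
    then show ?thesis
      using IVT'[of \<Phi> a p b] a b contPhi by (auto intro: continuous_at_imp_continuous_on)
  qed
  define \<Psi> where "\<Psi> p = (SOME x. \<Phi> x = p)" for p
  have inv: "\<Phi> (\<Psi> p) = p" if "0 < p" "p < 1" for p
    using someI_ex[OF ex[OF that]] by (simp add: \<Psi>_def)
  have inv': "\<Psi> (\<Phi> x) = x" for x
    unfolding \<Psi>_def by (rule some_equality) (metis mono linorder_neqE less_irrefl)+
  have derPsi: "(\<Psi> has_real_derivative inverse (?g (\<Psi> p))) (at p)" if "0 < p" "p < 1" for p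
  proof (rule DERIV_inverse_function[OF der _ that])
    show "?g (\<Psi> p) \<noteq> 0" using gpos[of "\<Psi> p"] by simp
    have "isCont \<Psi> (\<Phi> (\<Psi> p))"
      by (rule isCont_inverse_function[of 1]) (auto simp: inv' contPhi)
    then show "isCont \<Psi> p" using inv[OF that] by simp
  qed (use inv in auto)
  \<comment> \<open>\<open>1 - exp (- t)\<close> is the exponential distribution function, so \<open>T\<close> is the monotone transport.\<close>
  define T where "T t = \<Psi> (1 - exp (- t))" for t :: real
  define D where "D t = exp (- t) / ?g (T t)" for t :: real
  have "(T has_real_derivative D t) (at t)" if "t > 0" for t
  proof -
    have "((\<lambda>t. \<Psi> (1 - exp (- t))) has_real_derivative inverse (?g (\<Psi> (1 - exp (- t)))) * exp (- t)) (at t)"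
      by (rule DERIV_chain2[OF derPsi]) (use that in \<open>auto intro!: derivative_eq_intros\<close>)
    then show ?thesis by (simp add: T_def[abs_def] D_def field_simps)
  qed
  moreover have "0 < D t" "D t * ?g (T t) = exp (- t)" for t
    using gpos[of "T t"] by (auto simp: D_def)
  ultimately show ?thesis by blast
qed

lemma nn_integral_std_normal_density_vec:
  "(\<integral>\<^sup>+z. ennreal ((1 / sqrt (2 * pi)) ^ DIM('a) * exp (- (norm z)\<^sup>2 / 2)) \<partial>(lborel :: 'a::euclidean_space measure)) = 1"
proof -
  interpret product_sigma_finite "\<lambda>_ :: 'a. lborel :: real measure" ..
  have onb: "onb UNIV (Basis :: 'a set)"
    by (auto simp: onb_def pairwise_def orthogonal_def inner_Basis)
  have lb: "lborel = onb_lborel (Basis :: 'a set)"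
    using subspace_lborel_onb[OF onb] subspace_lborel_UNIV by metis
  have "(1 / sqrt (2 * pi)) ^ DIM('a) * exp (- (norm (\<Sum>b\<in>Basis. x b *\<^sub>R b))\<^sup>2 / 2)
      = (\<Prod>b\<in>Basis. std_normal_density (x b))" for x :: "'a \<Rightarrow> real"
  proof -
    have "(\<Prod>b\<in>(Basis::'a set). std_normal_density (x b)) = (1 / sqrt (2 * pi)) ^ DIM('a) * exp (\<Sum>b\<in>Basis. - (x b)\<^sup>2 / 2)"
      unfolding std_normal_density_def prod.distrib by (simp add: exp_sum)
    also have "(\<Sum>b\<in>(Basis::'a set). - (x b)\<^sup>2 / 2) = - (norm (\<Sum>b\<in>Basis. x b *\<^sub>R b))\<^sup>2 / 2"
      by (simp add: onb_norm[OF onb] sum_nonneg sum_negf sum_divide_distrib)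
    finally show ?thesis by simp
  qed
  then have "(\<integral>\<^sup>+z. ennreal ((1 / sqrt (2 * pi)) ^ DIM('a) * exp (- (norm z)\<^sup>2 / 2)) \<partial>(lborel :: 'a measure))
      = (\<integral>\<^sup>+x. (\<Prod>b\<in>Basis. ennreal (std_normal_density (x b))) \<partial>(\<Pi>\<^sub>M b\<in>(Basis::'a set). lborel))"
    unfolding lb by (subst nn_integral_onb_lborel) (auto simp: prod_ennreal)
  also have "\<dots> = (\<Prod>b\<in>(Basis::'a set). \<integral>\<^sup>+t. ennreal (std_normal_density t) \<partial>lborel)"
    by (rule product_nn_integral_prod) auto
  also have "(\<integral>\<^sup>+t. ennreal (std_normal_density t) \<partial>lborel) = 1"
    using prob_space.emeasure_space_1[OF prob_space_normal_density[of 1 0]]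
    by (simp add: emeasure_density)
  finally show ?thesis by simp
qed

section \<open>The Brascamp-Lieb inequality in coordinate spaces\<close>

lemma AE_inner_nonzero:
  fixes w :: "'a::euclidean_space"
  assumes "w \<noteq> 0"
  shows "AE y in lborel. w \<bullet> y \<noteq> 0"
proof -
  have "negligible {y. w \<bullet> y = 0}" using assms by (simp add: negligible_hyperplane)
  then have "{y. w \<bullet> y = 0} \<in> null_sets lborel"
    by (simp add: negligible_iff_null_sets null_sets_completion_iff)
  then show ?thesis by (rule AE_I') auto
qed

text \<open>The left side is the integral of the probability density \<open>G\<close> over the image of \<open>C\<close>.\<close>

lemma nn_integral_det_le_integral:
  fixes \<Theta> :: "real^'d::{finite,wellorder} \<Rightarrow> real^'d::_" and G :: "real^'d::_ \<Rightarrow> real"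
  assumes C: "open C" and der: "\<And>y. y \<in> C \<Longrightarrow> (\<Theta> has_derivative \<Theta>' y) (at y)" and inj: "inj_on \<Theta> C"
    and G: "G \<in> borel_measurable borel" "\<And>z. 0 \<le> G z" "(\<integral>\<^sup>+z. G z \<partial>lborel) = 1"
  shows "(\<integral>\<^sup>+y. indicator C y * ennreal (\<bar>det (matrix (\<Theta>' y))\<bar> * G (\<Theta> y)) \<partial>lborel) \<le> 1"
proof -
  have C': "C \<in> sets lebesgue" using C by simp
  have der': "\<And>y. y \<in> C \<Longrightarrow> (\<Theta> has_derivative \<Theta>' y) (at y within C)"
    using der has_derivative_at_withinI by blast
  have hi: "(G has_integral 1) UNIV"
    using has_integral_iff_nn_integral_lebesgue[of G 1] G
    by (simp add: nn_integral_completion measurable_completion)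
  then have aG: "G absolutely_integrable_on UNIV"
    using G(2) by (intro nonnegative_absolutely_integrable_1) (auto simp: has_integral_iff)
  have "\<Theta> ` C \<in> sets lebesgue"
    by (rule differentiable_image_in_sets_lebesgue[OF C'])
      (use der' in \<open>auto simp: differentiable_on_def differentiable_def\<close>)
  then have aG': "G absolutely_integrable_on \<Theta> ` C"
    using aG set_integrable_subset by blast
  have "integral (\<Theta> ` C) G \<le> integral UNIV G"
    using aG aG' G(2) by (intro integral_subset_le) (auto simp: absolutely_integrable_on_def)
  also have "\<dots> = 1" using hi by (simp add: integral_unique)
  finally have le1: "integral (\<Theta> ` C) G \<le> 1" .
  let ?f = "\<lambda>y. \<bar>det (matrix (\<Theta>' y))\<bar> * G (\<Theta> y)"
  \<comment> \<open>\<open>vec\<close> turns \<open>G\<close> into a function with values in \<open>real^1\<close>, the form in which the change of variables formula applies.\<close>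
  have "(\<lambda>y. \<bar>det (matrix (\<Theta>' y))\<bar> *\<^sub>R (vec (G (\<Theta> y)) :: real^1)) absolutely_integrable_on C \<and>
      integral C (\<lambda>y. \<bar>det (matrix (\<Theta>' y))\<bar> *\<^sub>R (vec (G (\<Theta> y)) :: real^1)) = vec (integral (\<Theta> ` C) G)
    \<longleftrightarrow> (\<lambda>z. vec (G z) :: real^1) absolutely_integrable_on (\<Theta> ` C) \<and>
      integral (\<Theta> ` C) (\<lambda>z. vec (G z) :: real^1) = vec (integral (\<Theta> ` C) G)"
    by (rule has_absolute_integral_change_of_variables[OF C' der' inj])
  then have "?f absolutely_integrable_on C \<and> integral C ?f = integral (\<Theta> ` C) G"
    using aG' by (simp add: absolutely_integrable_on_1_iff integral_on_1_eq)
  then have "(?f has_integral integral (\<Theta> ` C) G) C"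
    by (simp add: has_integral_iff absolutely_integrable_on_def)
  from nn_integral_has_integral_lebesgue[OF _ this] G(2)
  have "(\<integral>\<^sup>+y. ennreal (indicator C y * ?f y) \<partial>lborel) = ennreal (integral (\<Theta> ` C) G)"
    by simp
  then show ?thesis
    using le1 G(2) by (simp add: ennreal_mult' ennreal_indicator[symmetric])
qed

text \<open>Barthe's argument.  The sum of the weights is the dimension, which is what makes the product of the
  powers of the one dimensional Gaussian densities a Gaussian density of the whole space.\<close>

lemma brascamp_lieb_exponential_cart:
  fixes u :: "'j \<Rightarrow> real^'d::{finite,wellorder}"
  assumes dec: "identity_decomposition UNIV J c u" and a: "\<And>j. j \<in> J \<Longrightarrow> 0 < a j"
  shows "(\<integral>\<^sup>+y. ennreal (exp (- (\<Sum>j\<in>J. c j * a j * (u j \<bullet> y)))) * indicator {y. \<forall>j\<in>J. 0 \<le> u j \<bullet> y} y \<partial>lborel)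
    \<le> ennreal (\<Prod>j\<in>J. a j powr (- c j))"
proof -
  have fin: "finite J" and c: "\<And>j. j \<in> J \<Longrightarrow> 0 < c j" and u1: "\<And>j. j \<in> J \<Longrightarrow> norm (u j) = 1"
    using dec by (auto simp: identity_decomposition_def)
  have sumc: "(\<Sum>j\<in>J. c j) = CARD('d)"
    using identity_decomposition_sum_weights[OF dec] by simp
  obtain T D where TD: "\<And>t. t > 0 \<Longrightarrow> (T has_real_derivative D t) (at t)" "\<And>t. t > 0 \<Longrightarrow> 0 < D t"
      "\<And>t. t > 0 \<Longrightarrow> D t * std_normal_density (T t) = exp (- t)"
    using exponential_to_normal_transport by blast
  have T_mono: "T s < T t" if "0 < s" "s < t" for s t
  proof (rule DERIV_pos_imp_increasing[OF that(2)])
    fix x assume "s \<le> x"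
    then have "0 < x" using that by simp
    then show "\<exists>y. DERIV T x :> y \<and> 0 < y" using TD(1,2) by blast
  qed
  define C where "C = {y. \<forall>j\<in>J. 0 < u j \<bullet> y}"
  have "C = (\<Inter>j\<in>J. {y. 0 < u j \<bullet> y})" by (auto simp: C_def)
  then have "open C"
    using fin by (auto intro!: open_INT open_halfspace_gt)
  define \<Theta> where "\<Theta> y = (\<Sum>j\<in>J. (c j * T (a j * (u j \<bullet> y))) *\<^sub>R u j)" for y
  define \<Theta>' where "\<Theta>' y h = (\<Sum>j\<in>J. (c j * (a j * D (a j * (u j \<bullet> y))) * (u j \<bullet> h)) *\<^sub>R u j)" for y h
  have der: "(\<Theta> has_derivative \<Theta>' y) (at y)" if y: "y \<in> C" for y
    unfolding \<Theta>_def[abs_def] \<Theta>'_def[abs_def]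
  proof (rule has_derivative_sum)
    fix j assume j: "j \<in> J"
    then have pos: "0 < a j * (u j \<bullet> y)" using a y by (simp add: C_def)
    have "((\<lambda>y. a j * (u j \<bullet> y)) has_derivative (\<lambda>h. a j * (u j \<bullet> h))) (at y)"
      by (auto intro!: derivative_eq_intros)
    from has_derivative_compose[OF this TD(1)[OF pos, unfolded has_field_derivative_def]]
    show "((\<lambda>y. (c j * T (a j * (u j \<bullet> y))) *\<^sub>R u j) has_derivative
        (\<lambda>h. (c j * (a j * D (a j * (u j \<bullet> y))) * (u j \<bullet> h)) *\<^sub>R u j)) (at y)"
      by (auto intro!: derivative_eq_intros simp: mult_ac)
  qed
  have inj: "inj_on \<Theta> C"
    using inj_on_weighted_sum[OF dec, of "\<lambda>j t. T (a j * t)"] a T_mono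
    by (simp add: \<Theta>_def[abs_def] C_def)
  define G where "G z = (1 / sqrt (2 * pi)) ^ CARD('d) * exp (- (norm z)\<^sup>2 / 2)" for z :: "real^'d::_"
  have G: "G \<in> borel_measurable borel" "\<And>z. 0 \<le> G z" "(\<integral>\<^sup>+z. G z \<partial>lborel) = 1"
    using nn_integral_std_normal_density_vec[where 'a = "real^'d::_"] by (auto simp: G_def[abs_def])
  define \<alpha> where "\<alpha> = (\<Prod>j\<in>J. a j powr c j)"
  have \<alpha>: "0 < \<alpha>" unfolding \<alpha>_def using a by (intro prod_pos) (metis less_irrefl powr_gt_zero)
  let ?E = "\<lambda>y. exp (- (\<Sum>j\<in>J. c j * a j * (u j \<bullet> y)))"
  have key: "\<alpha> * ?E y \<le> \<bar>det (matrix (\<Theta>' y))\<bar> * G (\<Theta> y)" if y: "y \<in> C" for y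
  proof -
    define s where "s j = T (a j * (u j \<bullet> y))" for j
    define d where "d j = D (a j * (u j \<bullet> y))" for j
    have pos: "0 < a j * (u j \<bullet> y)" if "j \<in> J" for j using a y that by (simp add: C_def)
    have d: "0 < d j" if "j \<in> J" for j using TD(2)[OF pos[OF that]] by (simp add: d_def)
    have "?E y = (\<Prod>j\<in>J. exp (- (a j * (u j \<bullet> y))) powr c j)"
      using fin by (simp add: exp_powr_real exp_sum[symmetric] sum_negf mult_ac)
    also have "\<dots> = (\<Prod>j\<in>J. (d j * std_normal_density (s j)) powr c j)"
      using TD(3)[OF pos] by (intro prod.cong refl) (simp add: d_def s_def)
    also have "\<dots> = (\<Prod>j\<in>J. d j powr c j) * (\<Prod>j\<in>J. std_normal_density (s j) powr c j)"
      using d by (simp add: powr_mult less_imp_le prod.distrib cong: prod.cong)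
    also have "(\<Prod>j\<in>J. std_normal_density (s j) powr c j)
        = (\<Prod>j\<in>J. (1 / sqrt (2 * pi)) powr c j * exp (- (c j * (s j)\<^sup>2 / 2)))"
    proof (intro prod.cong refl)
      fix j
      have "std_normal_density (s j) powr c j = (1 / sqrt (2 * pi)) powr c j * exp (- (s j)\<^sup>2 / 2) powr c j"
        unfolding std_normal_density_def by (rule powr_mult)
      then show "std_normal_density (s j) powr c j = (1 / sqrt (2 * pi)) powr c j * exp (- (c j * (s j)\<^sup>2 / 2))"
        by (simp add: exp_powr_real mult.commute)
    qed
    also have "\<dots> = (1 / sqrt (2 * pi)) powr (\<Sum>j\<in>J. c j) * exp (- (\<Sum>j\<in>J. c j * (s j)\<^sup>2) / 2)"
      using fin by (simp add: prod.distrib powr_sum exp_sum[symmetric] sum_negf sum_divide_distrib)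
    also have "\<dots> \<le> G (\<Theta> y)"
      using norm_sum_identity_decomposition_le[OF dec, of s]
      by (simp add: G_def sumc powr_realpow \<Theta>_def s_def[symmetric] divide_right_mono)
    finally have E: "?E y \<le> (\<Prod>j\<in>J. d j powr c j) * G (\<Theta> y)"
      by (simp add: mult_left_mono prod_nonneg)
    have "\<alpha> * (\<Prod>j\<in>J. d j powr c j) = (\<Prod>j\<in>J. (a j * d j) powr c j)"
      using a d by (simp add: \<alpha>_def prod.distrib[symmetric] powr_mult less_imp_le cong: prod.cong)
    also have "\<dots> \<le> det (matrix (\<Theta>' y))"
      unfolding \<Theta>'_def[abs_def] d_def[symmetric]
      by (rule det_identity_decomposition_ge[OF dec]) (use a d in auto)
    finally have det: "\<alpha> * (\<Prod>j\<in>J. d j powr c j) \<le> \<bar>det (matrix (\<Theta>' y))\<bar>" by simp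
    have "\<alpha> * ?E y \<le> \<alpha> * ((\<Prod>j\<in>J. d j powr c j) * G (\<Theta> y))"
      using E \<alpha> by (simp add: mult_left_mono)
    also have "\<dots> \<le> \<bar>det (matrix (\<Theta>' y))\<bar> * G (\<Theta> y)"
      using det G(2) by (simp add: mult.assoc[symmetric] mult_right_mono)
    finally show ?thesis .
  qed
  let ?I = "\<integral>\<^sup>+y. ennreal (?E y) * indicator {y. \<forall>j\<in>J. 0 \<le> u j \<bullet> y} y \<partial>lborel"
  have [measurable]: "C \<in> sets borel" using \<open>open C\<close> by simp
  \<comment> \<open>The transport is defined on the open cone only; its boundary lies in finitely many hyperplanes.\<close>
  have "AE y in lborel. \<forall>j\<in>J. u j \<bullet> y \<noteq> 0"
  proof (intro AE_finite_allI[OF fin] AE_inner_nonzero)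
    show "u j \<noteq> 0" if "j \<in> J" for j using u1[OF that] by auto
  qed
  then have "?I = (\<integral>\<^sup>+y. ennreal (?E y) * indicator C y \<partial>lborel)"
    by (intro nn_integral_cong_AE) (auto simp: C_def order_le_less split: split_indicator elim!: eventually_mono)
  then have "ennreal \<alpha> * ?I = (\<integral>\<^sup>+y. ennreal \<alpha> * (ennreal (?E y) * indicator C y) \<partial>lborel)"
    by (simp add: nn_integral_cmult)
  also have "\<dots> \<le> (\<integral>\<^sup>+y. indicator C y * ennreal (\<bar>det (matrix (\<Theta>' y))\<bar> * G (\<Theta> y)) \<partial>lborel)"
    using key \<alpha> by (intro nn_integral_mono) (auto simp: ennreal_mult'[symmetric] ennreal_leI split: split_indicator)
  also have "\<dots> \<le> 1"
    by (rule nn_integral_det_le_integral[OF \<open>open C\<close> der inj G])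
  finally have "ennreal \<alpha> * ?I \<le> 1" .
  then have "ennreal (1 / \<alpha>) * (ennreal \<alpha> * ?I) \<le> ennreal (1 / \<alpha>) * 1"
    by (rule mult_left_mono) simp
  then have "?I \<le> ennreal (1 / \<alpha>)"
    using \<alpha> by (simp add: mult.assoc[symmetric] ennreal_mult'[symmetric])
  also have "1 / \<alpha> = (\<Prod>j\<in>J. a j powr (- c j))"
    by (simp add: \<alpha>_def powr_minus divide_inverse prod_inversef[symmetric] o_def)
  finally show ?thesis .
qed

section \<open>Lebesgue measure on subspaces\<close>

lemma sets_subspace_lborel [simp, measurable_cong]:
  "sets (subspace_lborel V) = sets borel"
  by (simp add: subspace_lborel_def)

lemma space_subspace_lborel [simp]: "space (subspace_lborel V) = UNIV"
  by (simp add: subspace_lborel_def)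

lemma AE_subspace_lborel_mem:
  fixes V :: "'a::euclidean_space set"
  assumes V: "subspace V"
  shows "AE z in subspace_lborel V. z \<in> V"
proof -
  obtain B where B: "onb V B" using onb_exists[OF V] by blast
  have BV: "b \<in> V" if "b \<in> B" for b using B that by (auto simp: onb_def)
  have [measurable]: "V \<in> sets borel" using closed_subspace[OF V] by simp
  have "(\<Sum>b\<in>B. x b *\<^sub>R b) \<in> V" for x
    using BV V by (intro subspace_sum subspace_scale)
  then show ?thesis
    unfolding subspace_lborel_onb[OF B] onb_lborel_def by (subst AE_distr_iff) auto
qed

lemma nn_integral_PiM_lborel_reindex:
  fixes p :: "'b \<Rightarrow> 'c"
  assumes "finite B" "bij_betw p B C"
    and g: "g \<in> borel_measurable (\<Pi>\<^sub>M b\<in>B. (lborel :: real measure))"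
  shows "(\<integral>\<^sup>+x. g (\<lambda>b\<in>B. x (p b)) \<partial>(\<Pi>\<^sub>M c\<in>C. (lborel :: real measure))) = (\<integral>\<^sup>+x. g x \<partial>(\<Pi>\<^sub>M b\<in>B. lborel))"
proof -
  let ?f = "\<lambda>x. \<lambda>b\<in>B. 0 + x (p b)"
  have "p b \<in> C" if "b \<in> B" for b using assms(2) that by (auto simp: bij_betw_def)
  then have f: "?f \<in> measurable (\<Pi>\<^sub>M c\<in>C. lborel) (\<Pi>\<^sub>M b\<in>B. (lborel :: real measure))"
    by (intro measurable_restrict) measurable
  have "(\<integral>\<^sup>+x. g x \<partial>(\<Pi>\<^sub>M b\<in>B. lborel)) = (\<integral>\<^sup>+x. g x \<partial>(distr (\<Pi>\<^sub>M c\<in>C. lborel) (\<Pi>\<^sub>M b\<in>B. lborel) ?f))"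
    by (simp only: distr_PiM_lborel[OF assms(1,2)])
  also have "\<dots> = (\<integral>\<^sup>+x. g (?f x) \<partial>(\<Pi>\<^sub>M c\<in>C. lborel))"
    by (rule nn_integral_distr[OF f]) (use g in simp)
  finally show ?thesis by simp
qed

lemma nn_integral_onb_reindex:
  fixes p :: "'a::euclidean_space \<Rightarrow> 'c"
  assumes B: "finite B" "bij_betw p B C" and g: "g \<in> borel_measurable borel"
  shows "(\<integral>\<^sup>+x. g (\<Sum>b\<in>B. x (p b) *\<^sub>R b) \<partial>(\<Pi>\<^sub>M c\<in>C. (lborel :: real measure))) = (\<integral>\<^sup>+z. g z \<partial>onb_lborel B)"
proof -
  have "(\<integral>\<^sup>+z. g z \<partial>onb_lborel B) = (\<integral>\<^sup>+x. g (\<Sum>b\<in>B. x b *\<^sub>R b) \<partial>(\<Pi>\<^sub>M b\<in>B. (lborel :: real measure)))"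
    by (rule nn_integral_onb_lborel[OF g])
  also have "\<dots> = (\<integral>\<^sup>+x. g (\<Sum>b\<in>B. (\<lambda>b\<in>B. x (p b)) b *\<^sub>R b) \<partial>(\<Pi>\<^sub>M c\<in>C. (lborel :: real measure)))"
    by (rule nn_integral_PiM_lborel_reindex[OF B, symmetric]) (use g in measurable)
  finally show ?thesis by simp
qed

lemma nn_integral_onb_scale:
  fixes g :: "'a::euclidean_space \<Rightarrow> ennreal"
  assumes B: "onb V B" and t: "0 < t" and g: "g \<in> borel_measurable borel"
  shows "(\<integral>\<^sup>+z. g z \<partial>onb_lborel B) = ennreal (t ^ dim V) * (\<integral>\<^sup>+z. g (t *\<^sub>R z) \<partial>onb_lborel B)"
proof -
  interpret product_sigma_finite "\<lambda>_ :: 'a. lborel :: real measure" ..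
  let ?P = "\<Pi>\<^sub>M b\<in>B. (lborel :: real measure)"
  let ?f = "\<lambda>x. \<lambda>b\<in>B. t * x b"
  have fin: "finite B" using onb_finite[OF B] .
  have f: "?f \<in> measurable ?P ?P" by (intro measurable_restrict) measurable
  \<comment> \<open>Both sides agree on boxes, where the claim is the scaling of lengths in each coordinate.\<close>
  have "density (distr ?P ?P ?f) (\<lambda>_. ennreal (t ^ dim V)) = ?P"
  proof (rule PiM_eqI[OF fin])
    fix A :: "'a \<Rightarrow> real set" assume A: "\<And>i. i \<in> B \<Longrightarrow> A i \<in> sets lborel"
    have scale: "(*) t -` A b \<in> sets lborel" "ennreal t * emeasure lborel ((*) t -` A b) = emeasure lborel (A b)"
      if b: "b \<in> B" for b
    proof -
      have m: "(*) t \<in> borel_measurable borel" by simp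
      show s: "(*) t -` A b \<in> sets lborel"
        using measurable_sets[OF m, of "A b"] A[OF b] by simp
      have "emeasure lborel (A b) = (\<integral>\<^sup>+x. indicator (A b) x \<partial>lborel)"
        using A[OF b] by simp
      also have "\<dots> = ennreal t * (\<integral>\<^sup>+x. indicator (A b) (0 + t * x) \<partial>lborel)"
        using t A[OF b] by (subst nn_integral_real_affine[of _ t 0]) auto
      also have "(\<lambda>x. indicator (A b) (0 + t * x) :: ennreal) = indicator ((*) t -` A b)"
        by (auto simp: indicator_def fun_eq_iff)
      finally show "ennreal t * emeasure lborel ((*) t -` A b) = emeasure lborel (A b)"
        using s by simp
    qed
    have PA: "Pi\<^sub>E B A \<in> sets ?P" using A fin by (intro sets_PiM_I_finite) auto
    have pre: "?f -` Pi\<^sub>E B A \<inter> space ?P = Pi\<^sub>E B (\<lambda>b. (*) t -` A b)"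
      by (auto simp: space_PiM PiE_iff)
    have "emeasure (density (distr ?P ?P ?f) (\<lambda>_. ennreal (t ^ dim V))) (Pi\<^sub>E B A)
        = ennreal (t ^ dim V) * emeasure (distr ?P ?P ?f) (Pi\<^sub>E B A)"
      using PA by (intro emeasure_density_const) auto
    also have "emeasure (distr ?P ?P ?f) (Pi\<^sub>E B A) = emeasure ?P (Pi\<^sub>E B (\<lambda>b. (*) t -` A b))"
      using PA by (subst emeasure_distr[OF f]) (simp_all only: pre)
    also have "\<dots> = (\<Prod>b\<in>B. emeasure lborel ((*) t -` A b))"
      using scale by (intro emeasure_PiM fin) auto
    also have "ennreal (t ^ dim V) * (\<Prod>b\<in>B. emeasure lborel ((*) t -` A b))
        = (\<Prod>b\<in>B. ennreal t * emeasure lborel ((*) t -` A b))"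
      using t onb_card[OF B] by (simp add: ennreal_power prod.distrib)
    also have "\<dots> = (\<Prod>b\<in>B. emeasure lborel (A b))"
      using scale by (intro prod.cong) auto
    finally show "emeasure (density (distr ?P ?P ?f) (\<lambda>_. ennreal (t ^ dim V))) (Pi\<^sub>E B A)
        = (\<Prod>b\<in>B. emeasure lborel (A b))" .
  qed simp
  then have eq: "?P = density (distr ?P ?P ?f) (\<lambda>_. ennreal (t ^ dim V))" by simp
  let ?h = "\<lambda>x. g (\<Sum>b\<in>B. x b *\<^sub>R b)"
  have h: "?h \<in> borel_measurable ?P" using g by measurable
  have "(\<integral>\<^sup>+x. ?h x \<partial>?P) = (\<integral>\<^sup>+x. ?h x \<partial>density (distr ?P ?P ?f) (\<lambda>_. ennreal (t ^ dim V)))"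
    by (subst (1) eq) (rule refl)
  also have "\<dots> = ennreal (t ^ dim V) * (\<integral>\<^sup>+x. ?h x \<partial>distr ?P ?P ?f)"
    using h by (subst nn_integral_density) (auto simp: nn_integral_cmult)
  also have "(\<integral>\<^sup>+x. ?h x \<partial>distr ?P ?P ?f) = (\<integral>\<^sup>+x. ?h (?f x) \<partial>?P)"
    by (rule nn_integral_distr[OF f]) (use h in simp)
  also have "\<dots> = (\<integral>\<^sup>+x. g (t *\<^sub>R (\<Sum>b\<in>B. x b *\<^sub>R b)) \<partial>?P)"
    by (simp add: scaleR_sum_right)
  finally show ?thesis
    using g by (simp add: nn_integral_onb_lborel)
qed

lemma nn_integral_subspace_scale:
  fixes g :: "'a::euclidean_space \<Rightarrow> ennreal"
  assumes V: "subspace V" and t: "0 < t" and g: "g \<in> borel_measurable borel"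
  shows "(\<integral>\<^sup>+z. g (t *\<^sub>R z) \<partial>subspace_lborel V) = ennreal ((1 / t) ^ dim V) * (\<integral>\<^sup>+z. g z \<partial>subspace_lborel V)"
proof -
  obtain B where B: "onb V B" using onb_exists[OF V] by blast
  have "ennreal ((1 / t) ^ dim V) * ennreal (t ^ dim V) = 1"
    using t by (simp add: ennreal_mult'[symmetric] power_mult_distrib[symmetric])
  then show ?thesis
    using nn_integral_onb_scale[OF B t g] by (simp add: subspace_lborel_onb[OF B] mult.assoc[symmetric])
qed

lemma nn_integral_subspace_translate:
  fixes g :: "'a::euclidean_space \<Rightarrow> ennreal"
  assumes V: "subspace V" and w: "w \<in> V" and g: "g \<in> borel_measurable borel"
  shows "(\<integral>\<^sup>+z. g (z + w) \<partial>subspace_lborel V) = (\<integral>\<^sup>+z. g z \<partial>subspace_lborel V)"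
proof -
  obtain B where B: "onb V B" using onb_exists[OF V] by blast
  have "(\<lambda>z. g (z + w)) \<in> borel_measurable borel" using g by measurable
  then show ?thesis
    using nn_integral_onb_translate[OF B w g] g by (simp add: subspace_lborel_onb[OF B] nn_integral_onb_lborel)
qed

lemma emeasure_subspace_lborel_bounded:
  fixes A :: "'a::euclidean_space set"
  assumes V: "subspace V" and A: "bounded A"
  shows "emeasure (subspace_lborel V) A < \<infinity>"
proof -
  obtain B where B: "onb V B" using onb_exists[OF V] by blast
  obtain R where R: "0 < R" "A \<subseteq> cball 0 R"
    using A by (metis bounded_pos mem_cball_0 subsetI)
  have "emeasure (subspace_lborel V) A \<le> emeasure (subspace_lborel V) (cball 0 R)"
    using R(2) by (intro emeasure_mono) auto
  also have "\<dots> = (\<integral>\<^sup>+z. indicator (cball 0 1) ((1 / R) *\<^sub>R z) \<partial>subspace_lborel V)"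
  proof -
    have "indicator (cball 0 R) z = (indicator (cball 0 1) ((1 / R) *\<^sub>R z) :: ennreal)" for z :: 'a
      using R(1) by (simp add: indicator_def divide_le_eq)
    moreover have "emeasure (subspace_lborel V) (cball 0 R) = (\<integral>\<^sup>+z. indicator (cball 0 R) z \<partial>subspace_lborel V)"
      by simp
    ultimately show ?thesis by (simp only:)
  qed
  also have "\<dots> = ennreal (R ^ dim V) * emeasure (subspace_lborel V) (cball 0 1)"
    using R(1) by (subst nn_integral_subspace_scale[OF V, of _ "indicator (cball 0 1)"])
      (auto intro!: borel_measurable_indicator borel_closed)
  also have "\<dots> < \<infinity>"
    using onb_unit_ball(2)[OF B] by (simp add: subspace_lborel_onb[OF B] ennreal_mult_less_top less_top)
  finally show ?thesis .
qed

lemma onb_Times_UNIV: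
  fixes H :: "'a::euclidean_space set"
  assumes B: "onb H B"
  shows "onb (H \<times> (UNIV :: real set)) (insert (0, 1) ((\<lambda>b. (b, 0)) ` B))"
proof -
  have H: "subspace H" "span B = H" using B by (auto simp: onb_def)
  have "H \<times> UNIV \<subseteq> span (insert (0, 1) ((\<lambda>b. (b, 0 :: real)) ` B))"
  proof safe
    fix x and r :: real assume x: "x \<in> H"
    have "linear (\<lambda>x :: 'a. (x, 0 :: real))" by (intro linearI) auto
    then have "span ((\<lambda>b. (b, 0 :: real)) ` B) = (\<lambda>x. (x, 0)) ` span B"
      by (rule linear_span_image)
    then have "(x, r) - r *\<^sub>R (0, 1) \<in> span ((\<lambda>b. (b, 0 :: real)) ` B)"
      using x H by auto
    then show "(x, r) \<in> span (insert (0, 1) ((\<lambda>b. (b, 0 :: real)) ` B))"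
      unfolding span_insert by blast
  qed
  moreover have sub: "insert (0, 1) ((\<lambda>b. (b, 0 :: real)) ` B) \<subseteq> H \<times> UNIV"
    using B H(1) by (auto simp: onb_def subspace_0)
  ultimately have "span (insert (0, 1) ((\<lambda>b. (b, 0 :: real)) ` B)) = H \<times> UNIV"
    using H(1) by (intro subset_antisym span_minimal subspace_Times) auto
  then show ?thesis
    using B sub by (auto simp: onb_def pairwise_def orthogonal_def)
qed

text \<open>Fubini's theorem, in the orthonormal basis that extends one of \<open>H\<close> by the vertical unit vector.\<close>

lemma nn_integral_subspace_Times_UNIV:
  fixes H :: "'a::euclidean_space set" and g :: "'a \<times> real \<Rightarrow> ennreal"
  assumes H: "subspace H" and g [measurable]: "g \<in> borel_measurable borel"
  shows "(\<integral>\<^sup>+z. g z \<partial>subspace_lborel (H \<times> UNIV)) = (\<integral>\<^sup>+r. \<integral>\<^sup>+x. g (x, r) \<partial>subspace_lborel H \<partial>lborel)"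
proof -
  interpret product_sigma_finite "\<lambda>_ :: 'a \<times> real. lborel :: real measure" ..
  obtain B where B: "onb H B" using onb_exists[OF H] by blast
  have fin: "finite B" using onb_finite[OF B] .
  let ?e = "\<lambda>b::'a. (b, 0::real)"
  have bij: "bij_betw ?e B (?e ` B)" by (auto simp: bij_betw_def inj_on_def)
  have gr: "(\<lambda>x. g (x, r)) \<in> borel_measurable borel" for r by measurable
  have "(\<integral>\<^sup>+z. g z \<partial>subspace_lborel (H \<times> UNIV))
      = (\<integral>\<^sup>+x. g (\<Sum>b\<in>insert (0, 1) (?e ` B). x b *\<^sub>R b) \<partial>(\<Pi>\<^sub>M b\<in>insert (0, 1) (?e ` B). lborel))"
    unfolding subspace_lborel_onb[OF onb_Times_UNIV[OF B]] by (rule nn_integral_onb_lborel[OF g])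
  also have "\<dots> = (\<integral>\<^sup>+r. \<integral>\<^sup>+x. g (\<Sum>b\<in>insert (0, 1) (?e ` B). (x((0, 1) := r)) b *\<^sub>R b)
      \<partial>(\<Pi>\<^sub>M b\<in>?e ` B. lborel) \<partial>lborel)"
    by (rule product_nn_integral_insert_rev) (use fin in auto)
  also have "\<dots> = (\<integral>\<^sup>+r. \<integral>\<^sup>+x. g (\<Sum>b\<in>B. x (b, 0) *\<^sub>R b, r) \<partial>(\<Pi>\<^sub>M b\<in>?e ` B. lborel) \<partial>lborel)"
  proof (intro nn_integral_cong arg_cong[where f = g])
    fix r :: real and x :: "'a \<times> real \<Rightarrow> real"
    have "(\<Sum>b\<in>?e ` B. (x((0, 1) := r)) b *\<^sub>R b) = (\<Sum>b\<in>B. (x (b, 0) *\<^sub>R b, 0))"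
      by (subst sum.reindex) (auto simp: inj_on_def)
    also have "\<dots> = (\<Sum>b\<in>B. x (b, 0) *\<^sub>R b, 0)"
      by (induction B rule: infinite_finite_induct) (auto simp: zero_prod_def)
    finally show "(\<Sum>b\<in>insert (0, 1) (?e ` B). (x((0, 1) := r)) b *\<^sub>R b) = (\<Sum>b\<in>B. x (b, 0) *\<^sub>R b, r)"
      using fin by (subst sum.insert) auto
  qed
  also have "\<dots> = (\<integral>\<^sup>+r. \<integral>\<^sup>+x. g (x, r) \<partial>subspace_lborel H \<partial>lborel)"
    unfolding subspace_lborel_onb[OF B]
    by (intro nn_integral_cong nn_integral_onb_reindex[OF fin bij gr])
  finally show ?thesis .
qed

lemma AE_subspace_Times_UNIV_snd:
  fixes H :: "'a::euclidean_space set"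
  assumes H: "subspace H"
  shows "AE z in subspace_lborel (H \<times> (UNIV :: real set)). snd z \<noteq> 0"
proof -
  have m: "{z :: 'a \<times> real. snd z = 0} \<in> sets borel"
    by (intro borel_closed closed_Collect_eq continuous_intros)
  have "emeasure (subspace_lborel (H \<times> UNIV)) {z :: 'a \<times> real. snd z = 0}
      = (\<integral>\<^sup>+z. indicator {z. snd z = 0} z \<partial>subspace_lborel (H \<times> (UNIV :: real set)))"
    using m by simp
  also have "\<dots> = (\<integral>\<^sup>+r. \<integral>\<^sup>+x. indicator {z. snd z = (0::real)} (x, r) \<partial>subspace_lborel H \<partial>lborel)"
    by (rule nn_integral_subspace_Times_UNIV[OF H, of "indicator {z. snd z = 0}"]) (use m in simp)
  also have "\<dots> = (\<integral>\<^sup>+r. 0 \<partial>(lborel :: real measure))"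
    by (rule nn_integral_cong_AE, rule eventually_mono[OF AE_lborel_singleton[of 0]]) (simp add: indicator_def)
  finally have "{z :: 'a \<times> real. snd z = 0} \<in> null_sets (subspace_lborel (H \<times> UNIV))"
    using m by (auto simp: null_sets_def)
  then show ?thesis by (rule AE_I') auto
qed

lemma dim_Times_UNIV_real:
  fixes H :: "'a::euclidean_space set"
  assumes "subspace H"
  shows "dim (H \<times> (UNIV :: real set)) = dim H + 1"
  using assms by (simp add: dim_Times)

section \<open>The Brascamp-Lieb inequality on subspaces\<close>

lemma nn_integral_exp_Ici: "(\<integral>\<^sup>+t. ennreal (exp (- t)) * indicator {0..} t \<partial>lborel) = (1::ennreal)"
  using nn_intergal_power_times_exp_Ici[of 0] by simp

text \<open>The dimension of \<open>F\<close> is not a type, so \<open>F\<close> is embedded into \<open>real^'d\<close> and the decomposition is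
  completed by the coordinate vectors orthogonal to the image, with weight and rate \<open>1\<close>.  Each of
  them contributes a factor \<open>\<integral> exp (- t) = 1\<close> over \<open>t \<ge> 0\<close>, so neither side changes.\<close>

lemma brascamp_lieb_exponential:
  fixes F :: "'a::euclidean_space set" and u :: "'j \<Rightarrow> 'a"
  assumes F: "subspace F" "dim F \<le> CARD('d::{finite,wellorder})"
    and dec: "identity_decomposition F J c u" and a: "\<And>j. j \<in> J \<Longrightarrow> 0 < a j"
  shows "(\<integral>\<^sup>+y. ennreal (exp (- (\<Sum>j\<in>J. c j * a j * (u j \<bullet> y)))) * indicator {y. \<forall>j\<in>J. 0 \<le> u j \<bullet> y} y \<partial>subspace_lborel F)
    \<le> ennreal (\<Prod>j\<in>J. a j powr (- c j))"
proof -
  interpret product_sigma_finite "\<lambda>_ :: real^'d::_. lborel :: real measure" ..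
  have fin: "finite J" and c: "\<And>j. j \<in> J \<Longrightarrow> 0 < c j"
    and u: "\<And>j. j \<in> J \<Longrightarrow> u j \<in> F" "\<And>j. j \<in> J \<Longrightarrow> norm (u j) = 1"
    using dec by (auto simp: identity_decomposition_def)
  obtain C where C: "onb F C" using onb_exists[OF F(1)] by blast
  have finC: "finite C" using onb_finite[OF C] .
  have CF: "b \<in> F" if "b \<in> C" for b using C that by (auto simp: onb_def)
  have "card C \<le> card (Basis :: (real^'d::_) set)" using onb_card[OF C] F(2) by simp
  then obtain \<iota> :: "'a \<Rightarrow> real^'d::_" where \<iota>: "\<iota> ` C \<subseteq> Basis" "inj_on \<iota> C"
    using card_le_inj[OF finC finite_Basis] by blast
  define R where "R = \<iota> ` C"
  have bij: "bij_betw \<iota> C R" using \<iota>(2) by (simp add: R_def bij_betw_def)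
  have R: "R \<subseteq> Basis" "finite R" using \<iota>(1) finC by (auto simp: R_def)
  have \<iota>_inner: "\<iota> b \<bullet> i = (if \<iota> b = i then 1 else 0)" if "b \<in> C" "i \<in> Basis" for b i
    using that \<iota>(1) by (auto simp: inner_Basis)
  \<comment> \<open>\<open>e\<close> embeds \<open>F\<close> isometrically as the span of \<open>R\<close>, and \<open>p\<close> is its adjoint.\<close>
  define e where "e y = (\<Sum>b\<in>C. (y \<bullet> b) *\<^sub>R \<iota> b)" for y
  define p where "p x = (\<Sum>b\<in>C. (x \<bullet> \<iota> b) *\<^sub>R b)" for x
  have ep: "e y \<bullet> x = y \<bullet> p x" for x y
    by (simp add: e_def p_def inner_sum_left inner_sum_right inner_commute mult.commute)
  have pF: "p x \<in> F" for x
    unfolding p_def using F(1) CF by (intro subspace_sum subspace_scale)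
  have lin: "linear e"
    by (intro linearI) (simp_all add: e_def inner_add_left scaleR_add_left sum.distrib scaleR_sum_right)
  have e_norm: "norm (e y) = norm y" if y: "y \<in> F" for y
  proof -
    have "p (e y) = (\<Sum>b\<in>C. (y \<bullet> b) *\<^sub>R b)"
      unfolding p_def
    proof (intro sum.cong refl)
      fix b assume b: "b \<in> C"
      have "e y \<bullet> \<iota> b = (\<Sum>b'\<in>C. if b' = b then y \<bullet> b' else 0)"
        unfolding e_def inner_sum_left
        using b \<iota> by (intro sum.cong refl) (auto simp: \<iota>_inner inj_on_eq_iff)
      then show "(e y \<bullet> \<iota> b) *\<^sub>R b = (y \<bullet> b) *\<^sub>R b" using b finC by simp
    qed
    then have "p (e y) = y" using onb_expand[OF C y] by simp
    then show ?thesis using ep[of y "e y"] by (simp add: norm_eq_sqrt_inner)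
  qed
  \<comment> \<open>The remaining coordinate vectors complete the embedded system to a decomposition of the identity.\<close>
  define J' where "J' = Inl ` J \<union> Inr ` (Basis - R)"
  define U where "U = case_sum (\<lambda>j. e (u j)) (\<lambda>i. i)"
  define c' where "c' = case_sum c (\<lambda>_::real^'d::_. 1 :: real)"
  define a' where "a' = case_sum a (\<lambda>_::real^'d::_. 1 :: real)"
  have sum_J': "(\<Sum>j\<in>J'. f j) = (\<Sum>j\<in>J. f (Inl j)) + (\<Sum>i\<in>Basis - R. f (Inr i))"
    for f :: "'j + real^'d::_ \<Rightarrow> 'z::comm_monoid_add"
    unfolding J'_def using fin
    by (subst sum.union_disjoint) (auto simp: sum.reindex)
  have prod_J': "(\<Prod>j\<in>J'. f j) = (\<Prod>j\<in>J. f (Inl j)) * (\<Prod>i\<in>Basis - R. f (Inr i))"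
    for f :: "'j + real^'d::_ \<Rightarrow> real"
    unfolding J'_def using fin
    by (subst prod.union_disjoint) (auto simp: prod.reindex)
  have dec': "identity_decomposition UNIV J' c' U"
    unfolding identity_decomposition_def
  proof (intro conjI ballI)
    show "finite J'" using fin by (simp add: J'_def)
    fix x :: "real^'d::_"
    have "(\<Sum>j\<in>J. (c j * (e (u j) \<bullet> x)) *\<^sub>R e (u j)) = e (\<Sum>j\<in>J. (c j * (u j \<bullet> p x)) *\<^sub>R u j)"
      by (simp add: ep linear_sum[OF lin] linear_scale[OF lin])
    also have "\<dots> = e (p x)" using dec pF by (simp add: identity_decomposition_def)
    also have "\<dots> = (\<Sum>b\<in>C. (x \<bullet> \<iota> b) *\<^sub>R \<iota> b)"
      unfolding e_def
    proof (intro sum.cong refl)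
      fix b assume b: "b \<in> C"
      have "p x \<bullet> b = (\<Sum>b'\<in>C. if b' = b then x \<bullet> \<iota> b' else 0)"
        unfolding p_def inner_sum_left using b
        by (intro sum.cong refl) (auto simp: onb_inner[OF C])
      then show "(p x \<bullet> b) *\<^sub>R \<iota> b = (x \<bullet> \<iota> b) *\<^sub>R \<iota> b" using b finC by simp
    qed
    also have "\<dots> = (\<Sum>i\<in>R. (x \<bullet> i) *\<^sub>R i)"
      by (rule sum.reindex_bij_betw[OF bij])
    finally have "(\<Sum>j\<in>J'. (c' j * (U j \<bullet> x)) *\<^sub>R U j)
        = (\<Sum>i\<in>R. (x \<bullet> i) *\<^sub>R i) + (\<Sum>i\<in>Basis - R. (x \<bullet> i) *\<^sub>R i)"
      by (simp add: sum_J' c'_def U_def inner_commute)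
    also have "\<dots> = (\<Sum>i\<in>Basis. (x \<bullet> i) *\<^sub>R i)"
      using R sum.subset_diff[OF R(1) finite_Basis, of "\<lambda>i. (x \<bullet> i) *\<^sub>R i"] by (simp add: add.commute)
    finally show "(\<Sum>j\<in>J'. (c' j * (U j \<bullet> x)) *\<^sub>R U j) = x"
      by (simp add: euclidean_representation)
  qed (use c u e_norm in \<open>auto simp: J'_def c'_def U_def\<close>)
  define h where "h z = ennreal (exp (- (\<Sum>j\<in>J'. c' j * a' j * (U j \<bullet> z)))) * indicator {z. \<forall>j\<in>J'. 0 \<le> U j \<bullet> z} z"
    for z
  define H where "H y = ennreal (exp (- (\<Sum>j\<in>J. c j * a j * (u j \<bullet> y)))) * indicator {y. \<forall>j\<in>J. 0 \<le> u j \<bullet> y} y"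
    for y
  have [measurable]: "H \<in> borel_measurable borel" "h \<in> borel_measurable borel"
  proof -
    have "closed {y. \<forall>j\<in>J. 0 \<le> u j \<bullet> y}" "closed {y. \<forall>j\<in>J'. 0 \<le> U j \<bullet> y}"
      unfolding Collect_ball_eq by (intro closed_INT closed_Collect_le ballI continuous_intros)+
    then have "{y. \<forall>j\<in>J. 0 \<le> u j \<bullet> y} \<in> sets borel" "{y. \<forall>j\<in>J'. 0 \<le> U j \<bullet> y} \<in> sets borel"
      using borel_closed by blast+
    then show "H \<in> borel_measurable borel" "h \<in> borel_measurable borel"
      unfolding H_def[abs_def] h_def[abs_def]
      by (intro borel_measurable_times_ennreal borel_measurable_indicator; measurable)+
  qed
  let ?\<phi> = "\<lambda>t::real. ennreal (exp (- t)) * indicator {0..} t"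
  have split: "h (\<Sum>i\<in>Basis. merge R (Basis - R) (x, y) i *\<^sub>R i)
      = H (\<Sum>b\<in>C. x (\<iota> b) *\<^sub>R b) * (\<Prod>i\<in>Basis - R. ?\<phi> (y i))" for x y
  proof -
    let ?z = "\<Sum>i\<in>Basis. merge R (Basis - R) (x, y) i *\<^sub>R i"
    have zi: "?z \<bullet> i = (if i \<in> R then x i else y i)" if "i \<in> Basis" for i
      using that by (simp add: merge_def)
    have 1: "U (Inl j) \<bullet> ?z = u j \<bullet> (\<Sum>b\<in>C. x (\<iota> b) *\<^sub>R b)" for j
    proof -
      have "p ?z = (\<Sum>b\<in>C. x (\<iota> b) *\<^sub>R b)"
        unfolding p_def using R \<iota>(1) by (intro sum.cong refl) (auto simp: zi R_def)
      then show ?thesis by (simp add: U_def ep)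
    qed
    have 2: "U (Inr i) \<bullet> ?z = y i" if "i \<in> Basis - R" for i
      using zi[of i] that by (simp add: U_def inner_commute)
    have "(\<Prod>i\<in>Basis - R. ?\<phi> (y i)) = ennreal (exp (- (\<Sum>i\<in>Basis - R. y i))) * indicator {y. \<forall>i\<in>Basis - R. 0 \<le> y i} y"
    proof (cases "\<forall>i\<in>Basis - R. 0 \<le> y i")
      case True
      then show ?thesis by (simp add: prod_ennreal exp_sum sum_negf[symmetric])
    next
      case False
      then obtain i where "i \<in> Basis - R" "\<not> 0 \<le> y i" by blast
      have "(\<Prod>i\<in>Basis - R. ?\<phi> (y i)) = 0"
        using \<open>i \<in> Basis - R\<close> \<open>\<not> 0 \<le> y i\<close> by (intro prod_zero bexI[of _ i]) auto
      moreover have "indicator {y. \<forall>i\<in>Basis - R. 0 \<le> y i} y = (0 :: ennreal)"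
        using \<open>i \<in> Basis - R\<close> \<open>\<not> 0 \<le> y i\<close> by (auto simp: indicator_def)
      ultimately show ?thesis by simp
    qed
    moreover have "(\<forall>j\<in>J'. 0 \<le> U j \<bullet> ?z) \<longleftrightarrow> (\<forall>j\<in>J. 0 \<le> u j \<bullet> (\<Sum>b\<in>C. x (\<iota> b) *\<^sub>R b)) \<and> (\<forall>i\<in>Basis - R. 0 \<le> y i)"
      unfolding J'_def ball_Un Set.ball_simps(9) using 1 2 by simp
    moreover have "(\<Sum>j\<in>J'. c' j * a' j * (U j \<bullet> ?z))
        = (\<Sum>j\<in>J. c j * a j * (u j \<bullet> (\<Sum>b\<in>C. x (\<iota> b) *\<^sub>R b))) + (\<Sum>i\<in>Basis - R. y i)"
      unfolding sum_J' 1 using 2 by (simp add: c'_def a'_def)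
    ultimately show ?thesis
      by (simp add: h_def H_def exp_add exp_diff exp_minus divide_inverse ennreal_mult' indicator_def)
  qed
  have onbB: "onb UNIV (Basis :: (real^'d::_) set)"
    by (auto simp: onb_def pairwise_def orthogonal_def inner_Basis)
  have "(\<integral>\<^sup>+z. h z \<partial>lborel) = (\<integral>\<^sup>+z. h z \<partial>onb_lborel Basis)"
    using subspace_lborel_onb[OF onbB] by (simp add: subspace_lborel_UNIV)
  also have "\<dots> = (\<integral>\<^sup>+x. h (\<Sum>i\<in>Basis. x i *\<^sub>R i) \<partial>(\<Pi>\<^sub>M i\<in>R \<union> (Basis - R). lborel))"
    using R(1) by (simp add: nn_integral_onb_lborel Un_absorb1)
  also have "\<dots> = (\<integral>\<^sup>+x. \<integral>\<^sup>+y. h (\<Sum>i\<in>Basis. merge R (Basis - R) (x, y) i *\<^sub>R i)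
      \<partial>(\<Pi>\<^sub>M i\<in>Basis - R. lborel) \<partial>(\<Pi>\<^sub>M i\<in>R. lborel))"
  proof (rule product_nn_integral_fold)
    have "(\<lambda>x. h (\<Sum>i\<in>Basis. x i *\<^sub>R i)) \<in> borel_measurable (\<Pi>\<^sub>M i\<in>Basis. lborel)" by measurable
    then show "(\<lambda>x. h (\<Sum>i\<in>Basis. x i *\<^sub>R i)) \<in> borel_measurable (\<Pi>\<^sub>M i\<in>R \<union> (Basis - R). lborel)"
      using R(1) by (simp add: Un_absorb1)
  qed (use R in auto)
  also have "\<dots> = (\<integral>\<^sup>+x. H (\<Sum>b\<in>C. x (\<iota> b) *\<^sub>R b) \<partial>(\<Pi>\<^sub>M i\<in>R. lborel))"
  proof (rule nn_integral_cong)
    fix x :: "real^'d::_ \<Rightarrow> real"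
    have "(\<integral>\<^sup>+y. (\<Prod>i\<in>Basis - R. ?\<phi> (y i)) \<partial>(\<Pi>\<^sub>M i\<in>Basis - R. lborel)) = (\<Prod>i\<in>Basis - R. \<integral>\<^sup>+t. ?\<phi> t \<partial>lborel)"
      by (rule product_nn_integral_prod) auto
    then have "(\<integral>\<^sup>+y. (\<Prod>i\<in>Basis - R. ?\<phi> (y i)) \<partial>(\<Pi>\<^sub>M i\<in>Basis - R. lborel)) = 1"
      by (simp add: nn_integral_exp_Ici)
    then show "(\<integral>\<^sup>+y. h (\<Sum>i\<in>Basis. merge R (Basis - R) (x, y) i *\<^sub>R i) \<partial>(\<Pi>\<^sub>M i\<in>Basis - R. lborel))
        = H (\<Sum>b\<in>C. x (\<iota> b) *\<^sub>R b)"
      unfolding split by (subst nn_integral_cmult) auto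
  qed
  also have "\<dots> = (\<integral>\<^sup>+y. H y \<partial>subspace_lborel F)"
    using nn_integral_onb_reindex[OF finC bij, of H] subspace_lborel_onb[OF C] by simp
  finally have "(\<integral>\<^sup>+y. H y \<partial>subspace_lborel F) = (\<integral>\<^sup>+z. h z \<partial>lborel)" by simp
  also have "\<dots> \<le> ennreal (\<Prod>j\<in>J'. a' j powr (- c' j))"
    unfolding h_def
    by (rule brascamp_lieb_exponential_cart[OF dec']) (use a in \<open>auto simp: a'_def J'_def\<close>)
  also have "\<dots> = ennreal (\<Prod>j\<in>J. a j powr (- c j))"
    by (simp add: prod_J' a'_def c'_def)
  finally show ?thesis by (simp add: H_def)
qed

text \<open>The case of equality: the integral factors into one dimensional ones.\<close>

lemma nn_integral_orthant:
  fixes B :: "'a::euclidean_space set"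
  assumes B: "onb V B"
  shows "(\<integral>\<^sup>+z. ennreal (exp (- (\<Sum>b\<in>B. b \<bullet> z))) * indicator {z. \<forall>b\<in>B. 0 \<le> b \<bullet> z} z \<partial>subspace_lborel V) = 1"
proof -
  interpret product_sigma_finite "\<lambda>_ :: 'a. lborel :: real measure" ..
  let ?\<phi> = "\<lambda>t::real. ennreal (exp (- t)) * indicator {0..} t"
  let ?g = "\<lambda>z. ennreal (exp (- (\<Sum>b\<in>B. b \<bullet> z))) * indicator {z. \<forall>b\<in>B. 0 \<le> b \<bullet> z} z"
  have fin: "finite B" using onb_finite[OF B] .
  have "closed {z. \<forall>b\<in>B. 0 \<le> b \<bullet> z}"
    unfolding Collect_ball_eq by (intro closed_INT closed_Collect_le ballI continuous_intros)
  then have "{z. \<forall>b\<in>B. 0 \<le> b \<bullet> z} \<in> sets borel" by (rule borel_closed)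
  then have g: "?g \<in> borel_measurable borel"
    by (intro borel_measurable_times_ennreal borel_measurable_indicator; measurable)
  have coord: "b \<bullet> (\<Sum>b\<in>B. x b *\<^sub>R b) = x b" if "b \<in> B" for b x
  proof -
    have "b \<bullet> (\<Sum>b\<in>B. x b *\<^sub>R b) = (\<Sum>b'\<in>B. if b' = b then x b' else 0)"
      unfolding inner_sum_right using that by (intro sum.cong refl) (auto simp: onb_inner[OF B])
    then show ?thesis using that fin by simp
  qed
  have split: "?g (\<Sum>b\<in>B. x b *\<^sub>R b) = (\<Prod>b\<in>B. ?\<phi> (x b))" for x
  proof (cases "\<forall>b\<in>B. 0 \<le> x b")
    case True
    then show ?thesis by (simp add: prod_ennreal exp_sum fin sum_negf[symmetric] coord)
  next
    case False
    then obtain b where "b \<in> B" "\<not> 0 \<le> x b" by blast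
    have "(\<Prod>b\<in>B. ?\<phi> (x b)) = 0"
      using \<open>b \<in> B\<close> \<open>\<not> 0 \<le> x b\<close> fin by (intro prod_zero bexI[of _ b]) auto
    moreover have "?g (\<Sum>b\<in>B. x b *\<^sub>R b) = 0"
      using False by (auto simp: coord)
    ultimately show ?thesis by (simp only:)
  qed
  have "(\<integral>\<^sup>+z. ?g z \<partial>subspace_lborel V) = (\<integral>\<^sup>+x. ?g (\<Sum>b\<in>B. x b *\<^sub>R b) \<partial>(\<Pi>\<^sub>M b\<in>B. lborel))"
    unfolding subspace_lborel_onb[OF B] by (rule nn_integral_onb_lborel[OF g])
  also have "\<dots> = (\<integral>\<^sup>+x. (\<Prod>b\<in>B. ?\<phi> (x b)) \<partial>(\<Pi>\<^sub>M b\<in>B. lborel))"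
    unfolding split ..
  also have "\<dots> = (\<Prod>b\<in>B. \<integral>\<^sup>+t. ?\<phi> t \<partial>lborel)"
    by (rule product_nn_integral_prod[OF fin]) auto
  also have "\<dots> = 1" by (simp add: nn_integral_exp_Ici)
  finally show ?thesis .
qed

section \<open>Integrals over cones\<close>

lemma nn_integral_power_exp:
  assumes "0 < \<beta>"
  shows "(\<integral>\<^sup>+r. ennreal (r ^ k * exp (- \<beta> * r)) * indicator {0..} r \<partial>lborel) = ennreal (fact k / \<beta> ^ (k + 1))"
proof -
  have "(\<integral>\<^sup>+r. ennreal (r ^ k * exp (- \<beta> * r)) * indicator {0..} r \<partial>lborel)
      = ennreal (1 / \<beta>) * (\<integral>\<^sup>+r. ennreal ((0 + 1 / \<beta> * r) ^ k * exp (- \<beta> * (0 + 1 / \<beta> * r))) * indicator {0..} (0 + 1 / \<beta> * r) \<partial>lborel)"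
    using assms by (subst nn_integral_real_affine[of _ "1 / \<beta>" 0]) auto
  also have "\<dots> = ennreal (1 / \<beta>) * (\<integral>\<^sup>+r. ennreal (1 / \<beta> ^ k) * (ennreal (r ^ k * exp (- r)) * indicator {0..} r) \<partial>lborel)"
    using assms
    by (intro arg_cong[where f = "\<lambda>x. ennreal (1 / \<beta>) * x"] nn_integral_cong)
      (auto simp: power_divide zero_le_divide_iff ennreal_mult'[symmetric] split: split_indicator)
  also have "\<dots> = ennreal (1 / \<beta>) * (ennreal (1 / \<beta> ^ k) * ennreal (fact k))"
    by (subst nn_integral_cmult) (auto simp: nn_intergal_power_times_exp_Ici)
  also have "\<dots> = ennreal (fact k / \<beta> ^ (k + 1))"
    using assms by (simp add: ennreal_mult'[symmetric])
  finally show ?thesis .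
qed

text \<open>The slice at height \<open>r\<close> is \<open>s r A\<close>, of volume \<open>(s r)^k\<close> times that of \<open>A\<close>, which leaves a Gamma
  integral.\<close>

lemma nn_integral_cone:
  fixes H :: "'a::euclidean_space set"
  assumes H: "subspace H" "dim H = k" and A [measurable]: "A \<in> sets borel" and pos: "0 < s" "0 < \<beta>"
  shows "(\<integral>\<^sup>+z. ennreal (exp (- \<beta> * snd z)) * indicator {z. 0 < snd z \<and> (1 / (s * snd z)) *\<^sub>R fst z \<in> A} z
      \<partial>subspace_lborel (H \<times> UNIV)) = ennreal (s ^ k * fact k / \<beta> ^ (k + 1)) * emeasure (subspace_lborel H) A"
proof -
  let ?g = "\<lambda>z :: 'a \<times> real. ennreal (exp (- \<beta> * snd z)) * indicator {z. 0 < snd z \<and> (1 / (s * snd z)) *\<^sub>R fst z \<in> A} z"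
  have g: "?g \<in> borel_measurable borel"
    by (simp add: borel_prod[symmetric])
  let ?v = "emeasure (subspace_lborel H) A"
  have inner: "(\<integral>\<^sup>+x. ?g (x, r) \<partial>subspace_lborel H)
      = (ennreal (s ^ k) * ?v) * (ennreal (r ^ k * exp (- \<beta> * r)) * indicator {0..} r)" if "r \<noteq> 0" for r
  proof (cases "0 < r")
    case True
    have "(\<integral>\<^sup>+x. ?g (x, r) \<partial>subspace_lborel H)
        = (\<integral>\<^sup>+x. ennreal (exp (- \<beta> * r)) * indicator A ((1 / (s * r)) *\<^sub>R x) \<partial>subspace_lborel H)"
      using True by (intro nn_integral_cong) (auto split: split_indicator)
    also have "\<dots> = ennreal (exp (- \<beta> * r)) * (\<integral>\<^sup>+x. indicator A ((1 / (s * r)) *\<^sub>R x) \<partial>subspace_lborel H)"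
      by (subst nn_integral_cmult) auto
    also have "(\<integral>\<^sup>+x. indicator A ((1 / (s * r)) *\<^sub>R x) \<partial>subspace_lborel H) = ennreal ((s * r) ^ k) * ?v"
      using True pos H(2) by (subst nn_integral_subspace_scale[OF H(1), of _ "indicator A"]) auto
    finally show ?thesis
      using True pos by (simp add: ennreal_mult' power_mult_distrib mult_ac)
  next
    case False
    then show ?thesis using that by (simp add: indicator_def)
  qed
  have "(\<integral>\<^sup>+z. ?g z \<partial>subspace_lborel (H \<times> UNIV)) = (\<integral>\<^sup>+r. \<integral>\<^sup>+x. ?g (x, r) \<partial>subspace_lborel H \<partial>lborel)"
    by (rule nn_integral_subspace_Times_UNIV[OF H(1) g])
  also have "\<dots> = (\<integral>\<^sup>+r. (ennreal (s ^ k) * ?v) * (ennreal (r ^ k * exp (- \<beta> * r)) * indicator {0..} r) \<partial>lborel)"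
    by (rule nn_integral_cong_AE, rule eventually_mono[OF AE_lborel_singleton[of 0]]) (rule inner)
  also have "\<dots> = (ennreal (s ^ k) * ?v) * ennreal (fact k / \<beta> ^ (k + 1))"
    using nn_integral_power_exp[OF pos(2), of k] by (subst nn_integral_cmult) auto
  also have "\<dots> = ennreal (s ^ k * fact k / \<beta> ^ (k + 1)) * ?v"
    using pos by (simp add: ennreal_mult'[symmetric] mult_ac) (simp add: mult.assoc[symmetric] ennreal_mult'[symmetric] mult_ac)
  finally show ?thesis .
qed

section \<open>Volume of the regular simplex\<close>

text \<open>Polarisation.  The centred vertices sum to zero, so summing the squared distances over one and then
  both vertices determines first the sum of all squared norms and then each of them.\<close>

lemma regular_simplex_centred_inner:
  fixes C :: "'a::euclidean_space set"
  assumes card: "card C = k + 1" and dist: "\<And>x y. \<lbrakk>x \<in> C; y \<in> C; x \<noteq> y\<rbrakk> \<Longrightarrow> dist x y = d"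
    and g: "g = (1 / real (k + 1)) *\<^sub>R \<Sum>C" and xy: "x \<in> C" "y \<in> C"
  shows "(x - g) \<bullet> (y - g) = d\<^sup>2 / 2 * ((if x = y then 1 else 0) - 1 / (real k + 1))"
proof -
  have fin: "finite C" using card by (metis card.infinite Suc_eq_plus1 nat.distinct(1))
  have sum0: "(\<Sum>y\<in>C. y - g) = 0"
    by (simp add: sum_subtractf card g) (simp add: scaleR_left.add[symmetric] sum_constant_scaleR card)
  define N where "N = (\<Sum>y\<in>C. (y - g) \<bullet> (y - g))"
  have pol: "(x - g) \<bullet> (x - g) + (y - g) \<bullet> (y - g) - 2 * ((x - g) \<bullet> (y - g)) = (if x = y then 0 else d\<^sup>2)"
    if "x \<in> C" "y \<in> C" for x y
  proof -
    have "(x - g) \<bullet> (x - g) + (y - g) \<bullet> (y - g) - 2 * ((x - g) \<bullet> (y - g)) = (dist x y)\<^sup>2"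
      by (simp add: dist_norm power2_norm_eq_inner inner_diff_left inner_diff_right inner_commute)
    then show ?thesis using dist[OF that] by auto
  qed
  have row: "real (k + 1) * ((x - g) \<bullet> (x - g)) + N = real k * d\<^sup>2" if x: "x \<in> C" for x
  proof -
    have cross: "(\<Sum>y\<in>C. (x - g) \<bullet> (y - g)) = 0"
      by (simp only: inner_sum_right[symmetric] sum0 inner_zero_right)
    have "real (k + 1) * ((x - g) \<bullet> (x - g)) + N
        = (\<Sum>y\<in>C. (x - g) \<bullet> (x - g) + (y - g) \<bullet> (y - g) - 2 * ((x - g) \<bullet> (y - g)))"
      by (simp only: sum.distrib sum_subtractf sum_distrib_left[symmetric] cross N_def sum_constant card)
    also have "\<dots> = (\<Sum>y\<in>C. if x = y then 0 else d\<^sup>2)"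
      using pol[OF x] by (intro sum.cong) auto
    also have "\<dots> = (\<Sum>y\<in>C - {x}. d\<^sup>2)"
      using fin x by (intro sum.mono_neutral_cong_right) auto
    also have "\<dots> = real k * d\<^sup>2" using fin x card by simp
    finally show ?thesis .
  qed
  have "(\<Sum>x\<in>C. real (k + 1) * ((x - g) \<bullet> (x - g)) + N) = (\<Sum>x\<in>C. real k * d\<^sup>2)"
    using row by (intro sum.cong) auto
  then have "real (k + 1) * (2 * N) = real (k + 1) * (real k * d\<^sup>2)"
    by (simp add: sum.distrib sum_distrib_left[symmetric] N_def[symmetric] card)
  then have N: "2 * N = real k * d\<^sup>2" by simp
  have nrm: "(x - g) \<bullet> (x - g) = real k * d\<^sup>2 / (2 * (real k + 1))" if "x \<in> C" for x
  proof -
    have "2 * ((real k + 1) * ((x - g) \<bullet> (x - g))) = real k * d\<^sup>2"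
      using row[OF that] N by (simp add: algebra_simps)
    then show ?thesis by (simp add: field_simps)
  qed
  have "real k * d\<^sup>2 / (2 * (real k + 1)) = d\<^sup>2 / 2 * (1 - 1 / (real k + 1))"
    by (simp add: field_simps)
  then have "2 * ((x - g) \<bullet> (y - g)) = 2 * (d\<^sup>2 / 2 * (1 - 1 / (real k + 1))) - (if x = y then 0 else d\<^sup>2)"
    using pol[OF xy] nrm[OF xy(1)] nrm[OF xy(2)] by linarith
  moreover have "i = t - D / 2 * (if P then 0 else 1)" if "2 * i = 2 * t - (if P then 0 else D)" for i t D :: real and P
    using that by (cases P) auto
  ultimately have "(x - g) \<bullet> (y - g) = d\<^sup>2 / 2 * (1 - 1 / (real k + 1)) - d\<^sup>2 / 2 * (if x = y then 0 else 1)"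
    by blast
  also have "\<dots> = d\<^sup>2 / 2 * (1 - 1 / (real k + 1) - (if x = y then 0 else 1))"
    by (rule right_diff_distrib[symmetric])
  finally show ?thesis by auto
qed

text \<open>The number on the left is the volume of the regular simplex of inradius \<open>1\<close>.  A regular simplex
  containing the unit ball has inradius at least \<open>1\<close> and so contains a translate of that simplex.
  The volume of the latter is read off from the cone over it in \<open>H \<times> \<real>\<close>, which is an orthant of
  an orthonormal basis.\<close>

lemma measure_regular_simplex_ge:
  fixes H S :: "'a::euclidean_space set"
  assumes H: "subspace H" "dim H = k" and S: "regular_simplex k S" "S \<subseteq> H" and ball: "cball 0 1 \<inter> H \<subseteq> S"
  shows "sqrt (real k) ^ k * sqrt (real k + 1) ^ (k + 1) / fact k \<le> measure (subspace_lborel H) S"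
proof -
  obtain C d0 where card: "card C = k + 1" and d0: "\<And>x y. \<lbrakk>x \<in> C; y \<in> C; x \<noteq> y\<rbrakk> \<Longrightarrow> dist x y = d0"
    and SC: "S = convex hull C"
    using S(1) by (auto simp: regular_simplex_def)
  have fin: "finite C" using card by (metis card.infinite Suc_eq_plus1 nat.distinct(1))
  have CH: "p \<in> H" if "p \<in> C" for p using S(2) SC hull_subset[of C convex] that by auto
  \<comment> \<open>A simplex with a single vertex has no edges, and any positive number serves as its edge length.\<close>
  obtain d where d: "0 < d" and dist: "\<And>x y. \<lbrakk>x \<in> C; y \<in> C; x \<noteq> y\<rbrakk> \<Longrightarrow> dist x y = d"
  proof (cases "k = 0")
    case True
    then have "x = y" if "x \<in> C" "y \<in> C" for x y
      using card that by (metis One_nat_def add_0 card_1_singletonE singletonD)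
    then show ?thesis using that[of 1] by auto
  next
    case False
    then obtain x y where "x \<in> C" "y \<in> C" "x \<noteq> y"
      using card by (metis One_nat_def Suc_eq_plus1 card_le_Suc0_iff_eq fin le_zero_eq not_less_eq_eq)
    then have "0 < d0" using d0[of x y] by (metis zero_less_dist_iff)
    then show ?thesis using that[of d0] d0 by blast
  qed
  define g where "g = (1 / real (k + 1)) *\<^sub>R \<Sum>C"
  have gH: "g \<in> H" unfolding g_def using H(1) CH by (intro subspace_scale subspace_sum) auto
  define q where "q p = (sqrt 2 / d) *\<^sub>R (p - g)" for p
  define w where "w = sqrt (real k + 1)"
  have w: "0 < w" "w * w = real k + 1" by (simp_all add: w_def)
  have qH: "q p \<in> H" if "p \<in> C" for p
    unfolding q_def using H(1) CH[OF that] gH by (intro subspace_scale subspace_diff)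
  define s where "s = sqrt (2::real)"
  have s: "0 < s" "s * s = 2" by (simp_all add: s_def)
  have inn: "(x - g) \<bullet> (y - g) = d\<^sup>2 / 2 * ((if x = y then 1 else 0) - 1 / (real k + 1))"
    if "x \<in> C" "y \<in> C" for x y
    by (rule regular_simplex_centred_inner[OF card _ g_def that]) (rule dist)
  have q_inner: "q x \<bullet> q y = (if x = y then 1 else 0) - 1 / (real k + 1)" if "x \<in> C" "y \<in> C" for x y
  proof -
    have "q x \<bullet> q y = (s * s) / (d * d) * ((x - g) \<bullet> (y - g))"
      by (simp only: q_def s_def inner_scaleR_left inner_scaleR_right) simp
    then show ?thesis
      using d by (simp only: s inn[OF that] power2_eq_square) simp
  qed
  have q_vertex: "q x \<bullet> (y - g) = d / s * ((if x = y then 1 else 0) - 1 / (real k + 1))"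
    if "x \<in> C" "y \<in> C" for x y
  proof -
    have "q x \<bullet> (y - g) = s / d * ((x - g) \<bullet> (y - g))"
      by (simp only: q_def s_def inner_scaleR_left)
    also have "\<dots> = (s / d * (d\<^sup>2 / (s * s))) * ((if x = y then 1 else 0) - 1 / (real k + 1))"
      by (simp only: s inn[OF that] mult.assoc)
    also have "s / d * (d\<^sup>2 / (s * s)) = d / s" using d s(1) by (simp add: power2_eq_square)
    finally show ?thesis .
  qed
  have q_sum: "(\<Sum>p\<in>C. q p) = 0"
  proof -
    have "(\<Sum>p\<in>C. p - g) = 0"
      by (simp add: sum_subtractf card g_def) (simp add: scaleR_left.add[symmetric] sum_constant_scaleR card)
    then show ?thesis by (simp add: q_def scaleR_sum_right[symmetric])
  qed
  \<comment> \<open>The extra coordinate \<open>1 / w\<close> cancels the common inner product \<open>- 1 / (k + 1)\<close> of distinct \<open>q p\<close>.\<close>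
  define U where "U p = (q p, 1 / w)" for p
  have U_inner: "U x \<bullet> U y = (if x = y then 1 else 0)" if "x \<in> C" "y \<in> C" for x y
    using q_inner[OF that] w by (simp add: U_def field_simps)
  have U_inj: "inj_on U C"
    by (rule inj_onI) (metis U_inner zero_neq_one)
  let ?F = "H \<times> (UNIV :: real set)"
  have onbU: "onb ?F (U ` C)"
  proof -
    have sub: "U ` C \<subseteq> ?F" using qH by (auto simp: U_def)
    have orth: "pairwise orthogonal (U ` C)"
      by (auto simp: pairwise_def orthogonal_def U_inner)
    have nrm: "norm (U p) = 1" if "p \<in> C" for p
      using U_inner[OF that that] by (simp add: norm_eq_sqrt_inner)
    have "0 \<notin> U ` C" using nrm by force
    then have ind: "independent (U ` C)" by (rule pairwise_orthogonal_independent[OF orth])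
    have "dim ?F \<le> card (U ` C)"
      using H card by (simp add: dim_Times_UNIV_real card_image[OF U_inj])
    then have "?F \<subseteq> span (U ` C)" using card_ge_dim_independent[OF sub ind] by blast
    moreover have "span (U ` C) \<subseteq> ?F"
      using sub H(1) by (intro span_minimal subspace_Times) auto
    ultimately show ?thesis using sub orth nrm by (auto simp: onb_def)
  qed
  have U_sum: "(\<Sum>b\<in>U ` C. b \<bullet> z) = w * snd z" for z
  proof -
    have "(\<Sum>b\<in>U ` C. b \<bullet> z) = (\<Sum>p\<in>C. U p \<bullet> z)"
      by (simp add: sum.reindex[OF U_inj])
    also have "\<dots> = (\<Sum>p\<in>C. q p) \<bullet> fst z + real (k + 1) / w * snd z"
      by (simp add: U_def inner_prod_def sum.distrib inner_sum_left card)
    also have "real (k + 1) / w = w" using w by (simp add: field_simps)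
    finally show ?thesis using q_sum by simp
  qed
  \<comment> \<open>\<open>A \<inter> H\<close> is the slice at height \<open>1\<close> of the orthant spanned by the \<open>U p\<close>; for \<open>k > 0\<close> it is a regular simplex of inradius \<open>1 / sqrt k\<close>.\<close>
  define A where "A = {x. \<forall>p\<in>C. - 1 / w \<le> q p \<bullet> x}"
  have A [measurable]: "A \<in> sets borel"
    unfolding A_def Collect_ball_eq by (intro borel_closed closed_INT closed_Collect_le ballI continuous_intros)
  have "1 = (\<integral>\<^sup>+z. ennreal (exp (- (\<Sum>b\<in>U ` C. b \<bullet> z))) * indicator {z. \<forall>b\<in>U ` C. 0 \<le> b \<bullet> z} z \<partial>subspace_lborel ?F)"
    using nn_integral_orthant[OF onbU] by simp
  also have "\<dots> = (\<integral>\<^sup>+z. ennreal (exp (- w * snd z)) * indicator {z. 0 < snd z \<and> (1 / (1 * snd z)) *\<^sub>R fst z \<in> A} z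
      \<partial>subspace_lborel ?F)"
  proof (rule nn_integral_cong_AE, rule eventually_mono[OF AE_subspace_Times_UNIV_snd[OF H(1)]])
    fix z :: "'a \<times> real" assume z: "snd z \<noteq> 0"
    have "0 \<le> w * snd z" if "\<forall>b\<in>U ` C. 0 \<le> b \<bullet> z"
      unfolding U_sum[symmetric] using that by (intro sum_nonneg) auto
    then have "(\<forall>b\<in>U ` C. 0 \<le> b \<bullet> z) \<longleftrightarrow> 0 < snd z \<and> (\<forall>p\<in>C. 0 \<le> U p \<bullet> z)"
      using w(1) z by (auto simp: zero_le_mult_iff)
    also have "\<dots> \<longleftrightarrow> 0 < snd z \<and> (1 / (1 * snd z)) *\<^sub>R fst z \<in> A"
      using w(1) by (auto simp: A_def U_def inner_prod_def field_simps)
    finally show "ennreal (exp (- (\<Sum>b\<in>U ` C. b \<bullet> z))) * indicator {z. \<forall>b\<in>U ` C. 0 \<le> b \<bullet> z} z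
        = ennreal (exp (- w * snd z)) * indicator {z. 0 < snd z \<and> (1 / (1 * snd z)) *\<^sub>R fst z \<in> A} z"
      unfolding U_sum by (simp add: indicator_def)
  qed
  also have "\<dots> = ennreal (1 ^ k * fact k / w ^ (k + 1)) * emeasure (subspace_lborel H) A"
    by (rule nn_integral_cone[OF H A _ w(1)]) simp
  finally have "ennreal (w ^ (k + 1) / fact k) * (ennreal (fact k / w ^ (k + 1)) * emeasure (subspace_lborel H) A)
      = ennreal (w ^ (k + 1) / fact k)" by simp
  then have volA: "emeasure (subspace_lborel H) A = ennreal (w ^ (k + 1) / fact k)"
    using w(1) by (simp add: mult.assoc[symmetric] ennreal_mult'[symmetric])
  \<comment> \<open>For \<open>k > 0\<close> the inradius of \<open>S\<close> is \<open>d / (s sqrt k w)\<close>.  The unit ball does not cross any facet hyperplane; summing these conditions over the facets cancels the unknown position of \<open>g\<close>.\<close>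
  have d_ge: "s * (sqrt k * w) \<le> d"
  proof (cases "k = 0")
    case True then show ?thesis using d by simp
  next
    case False
    have le: "- (d / s) / (real k + 1) \<le> q p \<bullet> (x - g)" if p: "p \<in> C" and x: "x \<in> S" for p x
    proof -
      let ?T = "{x. - (d / s) / (real k + 1) + q p \<bullet> g \<le> q p \<bullet> x}"
      have "y \<in> ?T" if "y \<in> C" for y
      proof -
        have "d / s * (0 - 1 / (real k + 1)) \<le> q p \<bullet> (y - g)"
          unfolding q_vertex[OF p that] using d s by (intro mult_left_mono) auto
        then show ?thesis by (simp add: inner_diff_right)
      qed
      then have "convex hull C \<subseteq> ?T"
        by (intro hull_minimal convex_halfspace_ge) auto
      then show ?thesis using x SC by (auto simp: inner_diff_right algebra_simps)
    qed
    have nq: "norm (q p) = sqrt k / w" if "p \<in> C" for p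
    proof -
      have "q p \<bullet> q p = real k / (w * w)"
        using q_inner[OF that that] by (simp add: w field_simps)
      then show ?thesis using w(1) by (simp add: norm_eq_sqrt_inner real_sqrt_divide)
    qed
    have pos: "0 < sqrt k / w" using False w(1) by simp
    have "- (d / s) / (real k + 1) \<le> - (sqrt k / w) - q p \<bullet> g" if p: "p \<in> C" for p
    proof -
      let ?x = "(- 1 / norm (q p)) *\<^sub>R q p"
      have nx: "norm ?x = 1" using pos nq[OF p] False w(1) by simp
      have "?x \<in> cball 0 1 \<inter> H"
        unfolding Int_iff mem_cball_0 nx using subspace_scale[OF H(1) qH[OF p]] by blast
      then have "?x \<in> S" using ball by blast
      moreover have "q p \<bullet> ?x = - norm (q p)"
        by (simp add: dot_square_norm power2_eq_square)
      ultimately show ?thesis using le[OF p, of ?x] nq[OF p] by (simp add: inner_diff_right)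
    qed
    then have "(\<Sum>p\<in>C. - (d / s) / (real k + 1)) \<le> (\<Sum>p\<in>C. - (sqrt k / w) - q p \<bullet> g)"
      by (rule sum_mono)
    also have "\<dots> = - (real (k + 1) * (sqrt k / w)) - (\<Sum>p\<in>C. q p) \<bullet> g"
      by (simp add: sum_subtractf inner_sum_left card)
    also have "\<dots> = - (w * sqrt k)"
    proof -
      have "real (k + 1) = w * w" using w by simp
      then show ?thesis using w(1) by (simp only: q_sum inner_zero_left) simp
    qed
    finally have "(\<Sum>p\<in>C. - (d / s) / (real k + 1)) \<le> - (w * sqrt k)" .
    moreover have "(\<Sum>p\<in>C. - (d / s) / (real k + 1)) = - (d / s)"
      using card by (simp add: add.commute)
    ultimately have "w * sqrt k \<le> d / s" by linarith
    then show ?thesis using s(1) by (simp add: pos_le_divide_eq mult.commute mult.left_commute)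
  qed
  \<comment> \<open>\<open>S0 \<inter> H\<close> is the regular simplex of inradius \<open>1\<close> with the centroid and the directions of \<open>S\<close>.\<close>
  define S0 where "S0 = {x. \<forall>p\<in>C. - sqrt k / w \<le> q p \<bullet> (x - g)}"
  have S0 [measurable]: "S0 \<in> sets borel"
    unfolding S0_def Collect_ball_eq by (intro borel_closed closed_INT closed_Collect_le ballI continuous_intros)
  have S0S: "S0 \<inter> H \<subseteq> S"
  proof
    fix x assume x: "x \<in> S0 \<inter> H"
    define y where "y = x - g"
    have yH: "y \<in> H" using x gH H(1) by (auto simp: y_def intro: subspace_diff)
    have "(\<Sum>b\<in>U ` C. ((y, 0) \<bullet> b) *\<^sub>R b) = (y, 0)"
      by (rule onb_expand[OF onbU]) (use yH in auto)
    then have "(\<Sum>p\<in>C. ((y, 0) \<bullet> U p) *\<^sub>R U p) = (y, 0)"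
      by (simp only: sum.reindex[OF U_inj] o_def)
    then have "fst (\<Sum>p\<in>C. ((y, 0) \<bullet> U p) *\<^sub>R U p) = y" by simp
    then have y: "(\<Sum>p\<in>C. (q p \<bullet> y) *\<^sub>R q p) = y"
      by (simp add: fst_sum U_def inner_commute)
    \<comment> \<open>The barycentric coordinates of \<open>x\<close>, found by expanding \<open>x - g\<close> in the orthonormal basis \<open>U\<close>.\<close>
    define \<mu> where "\<mu> p = 1 / (real k + 1) + s / d * (q p \<bullet> y)" for p
    have pq: "p = g + (d / s) *\<^sub>R q p" for p using d s by (simp add: q_def s_def[symmetric])
    have "(\<Sum>p\<in>C. q p \<bullet> y) = 0" using q_sum by (simp add: inner_sum_left[symmetric])
    moreover have "sum \<mu> C = real (k + 1) * (1 / (real k + 1)) + s / d * (\<Sum>p\<in>C. q p \<bullet> y)"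
      by (simp only: \<mu>_def[abs_def] sum.distrib sum_distrib_left[symmetric] sum_constant card)
    ultimately have \<mu>_sum: "sum \<mu> C = 1" by simp
    have "\<mu> p *\<^sub>R p = \<mu> p *\<^sub>R g + (d / s / (real k + 1)) *\<^sub>R q p + (q p \<bullet> y) *\<^sub>R q p" for p
    proof -
      have "\<mu> p *\<^sub>R p = \<mu> p *\<^sub>R (g + (d / s) *\<^sub>R q p)" using pq[of p] by simp
      also have "\<dots> = \<mu> p *\<^sub>R g + (\<mu> p * (d / s)) *\<^sub>R q p" by (simp add: scaleR_add_right)
      also have "\<mu> p * (d / s) = d / s / (real k + 1) + q p \<bullet> y"
      proof -
        have "s / d * (q p \<bullet> y) * (d / s) = q p \<bullet> y" using d s(1) by simp
        moreover have "1 / (real k + 1) * (d / s) = d / s / (real k + 1)" by simp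
        ultimately show ?thesis by (simp only: \<mu>_def distrib_right)
      qed
      finally show ?thesis by (simp add: scaleR_add_left)
    qed
    then have "(\<Sum>p\<in>C. \<mu> p *\<^sub>R p)
        = sum \<mu> C *\<^sub>R g + (d / s / (real k + 1)) *\<^sub>R (\<Sum>p\<in>C. q p) + (\<Sum>p\<in>C. (q p \<bullet> y) *\<^sub>R q p)"
      by (simp only: sum.distrib scaleR_sum_left scaleR_sum_right)
    also have "\<dots> = g + y" by (simp only: \<mu>_sum q_sum y) simp
    finally have x_eq: "(\<Sum>p\<in>C. \<mu> p *\<^sub>R p) = x" by (simp add: y_def)
    have "0 \<le> \<mu> p" if p: "p \<in> C" for p
    proof -
      have "s * (sqrt k * w) / d \<le> 1" using d_ge d by simp
      then have "s * (sqrt k * w) / d / (w * w) \<le> 1 / (w * w)"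
        using w(1) by (intro divide_right_mono) auto
      then have "s / d * (sqrt k / w) \<le> 1 / (real k + 1)"
        unfolding w(2)[symmetric] using w(1) d by (simp add: mult_ac)
      moreover have "s / d * (- sqrt k / w) \<le> s / d * (q p \<bullet> y)"
        using x p d s(1) by (intro mult_left_mono) (auto simp: S0_def y_def)
      ultimately show ?thesis by (simp add: \<mu>_def)
    qed
    then show "x \<in> S"
      unfolding SC convex_hull_finite[OF fin] using \<mu>_sum x_eq by blast
  qed
  have volS0: "emeasure (subspace_lborel H) S0 = ennreal (sqrt k ^ k) * emeasure (subspace_lborel H) A"
  proof -
    have "emeasure (subspace_lborel H) S0 = (\<integral>\<^sup>+z. indicator S0 z \<partial>subspace_lborel H)" by simp
    also have "\<dots> = (\<integral>\<^sup>+z. indicator S0 (z + g) \<partial>subspace_lborel H)"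
      by (rule nn_integral_subspace_translate[OF H(1) gH, symmetric]) simp
    also have "\<dots> = ennreal (sqrt k ^ k) * emeasure (subspace_lborel H) A"
    \<comment> \<open>For \<open>k = 0\<close> the scaling factor \<open>sqrt k\<close> is zero, but both sets are everything.\<close>
    proof (cases "k = 0")
      case True
      have "q p = 0" if "p \<in> C" for p
        using q_inner[OF that that] True by simp
      then have "S0 = UNIV" "A = UNIV" using True w(1) by (auto simp: S0_def A_def)
      then show ?thesis using True by simp
    next
      case False
      then have pos: "0 < sqrt k" by simp
      have "indicator S0 (z + g) = (indicator A ((1 / sqrt k) *\<^sub>R z) :: ennreal)" for z
        using pos w(1) by (simp add: indicator_def S0_def A_def field_simps)
      then have "(\<integral>\<^sup>+z. indicator S0 (z + g) \<partial>subspace_lborel H)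
          = (\<integral>\<^sup>+z. indicator A ((1 / sqrt k) *\<^sub>R z) \<partial>subspace_lborel H)" by (simp only:)
      also have "\<dots> = ennreal (sqrt k ^ k) * emeasure (subspace_lborel H) A"
        using pos H(2) by (subst nn_integral_subspace_scale[OF H(1), of _ "indicator A"]) auto
      finally show ?thesis .
    qed
    finally show ?thesis .
  qed
  have cpt: "compact S" unfolding SC using fin by (intro compact_convex_hull finite_imp_compact)
  have "ennreal (sqrt (real k) ^ k * w ^ (k + 1) / fact k) = emeasure (subspace_lborel H) S0"
    using w(1) by (simp add: volS0 volA ennreal_mult'[symmetric])
  also have "\<dots> \<le> emeasure (subspace_lborel H) S"
  proof (rule emeasure_mono_AE, rule eventually_mono[OF AE_subspace_lborel_mem[OF H(1)]])
    show "S \<in> sets (subspace_lborel H)" using cpt by (simp add: compact_imp_closed)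
  qed (use S0S in auto)
  also have "\<dots> = ennreal (measure (subspace_lborel H) S)"
    using emeasure_subspace_lborel_bounded[OF H(1) compact_imp_bounded[OF cpt]]
    by (intro emeasure_eq_ennreal_measure) auto
  finally show ?thesis by (simp add: w_def)
qed

section \<open>Lifting a decomposition in John's position\<close>

text \<open>A hyperplane supporting \<open>K\<close> at \<open>v\<close> also supports the unit ball there, and the ball has only one
  such hyperplane.\<close>

lemma contact_point_halfspace:
  fixes K :: "'a::euclidean_space set"
  assumes K: "convex K" "cball 0 1 \<subseteq> K" and v: "v \<in> frontier K" "norm v = 1" and x: "x \<in> K"
  shows "v \<bullet> x \<le> 1"
proof -
  have "interior K \<noteq> {}"
    using interior_mono[OF K(2)] by auto
  then have ri: "rel_interior K = interior K" by (rule rel_interior_nonempty_interior)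
  have "v \<in> closure K" "v \<notin> rel_interior K" using v(1) ri by (auto simp: frontier_def)
  then obtain a where a: "a \<noteq> 0" "\<And>y. y \<in> closure K \<Longrightarrow> a \<bullet> v \<le> a \<bullet> y"
    using supporting_hyperplane_relative_frontier[OF K(1)] by metis
  have "- (a /\<^sub>R norm a) \<in> cball 0 1" using a(1) by simp
  then have "- (a /\<^sub>R norm a) \<in> closure K" using K(2) closure_subset by blast
  from a(2)[OF this] have av: "a \<bullet> v \<le> - norm a"
    using a(1) by (simp add: dot_square_norm power2_eq_square mult.assoc[symmetric])
  \<comment> \<open>Equality in the Cauchy-Schwarz inequality: the outer normal \<open>- a\<close> is a positive multiple of \<open>v\<close>.\<close>
  have "(norm (a + norm a *\<^sub>R v))\<^sup>2 = 2 * norm a * (norm a + a \<bullet> v)"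
    using v(2) by (simp add: power2_norm_eq_inner inner_add_left inner_add_right inner_commute
        algebra_simps) (simp add: dot_square_norm power2_eq_square)
  also have "\<dots> \<le> 0" using av by (intro mult_nonneg_nonpos) auto
  finally have "a = - (norm a *\<^sub>R v)" by (simp add: eq_neg_iff_add_eq_0)
  moreover have "a \<bullet> v \<le> a \<bullet> x" using a(2) x closure_subset by blast
  ultimately have "- (norm a * (v \<bullet> v)) \<le> - (norm a * (v \<bullet> x))"
    by (metis inner_minus_left inner_scaleR_left)
  then show ?thesis using a(1) v(2) by (simp add: dot_square_norm)
qed

lemma john_lift_inner:
  fixes v :: "'a::euclidean_space"
  assumes "0 < n"
  shows "(sqrt (real n / (real n + 1)) *\<^sub>R (- v, 1 / sqrt (real n))) \<bullet> (x, r)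
    = (r - sqrt (real n) * (v \<bullet> x)) / sqrt (real n + 1)"
  using assms by (simp add: inner_prod_def real_sqrt_divide field_simps)

text \<open>The weights \<open>c j\<close> sum to \<open>n\<close>, so the last coordinate \<open>1 / sqrt n\<close> contributes exactly the square
  of the height to the quadratic form; the mixed terms vanish because the \<open>v j\<close> are centred.\<close>

lemma john_lift_decomposition:
  fixes v :: "'j \<Rightarrow> 'a::euclidean_space"
  assumes dec: "identity_decomposition UNIV J c v" and centred: "(\<Sum>j\<in>J. c j *\<^sub>R v j) = 0"
    and n: "n = DIM('a)"
  defines "\<delta> \<equiv> \<lambda>j. (real n + 1) / real n * c j"
    and "vt \<equiv> \<lambda>j. sqrt (real n / (real n + 1)) *\<^sub>R (- v j, 1 / sqrt (real n))"
  shows "identity_decomposition UNIV J \<delta> vt"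
    and "(\<Sum>j\<in>J. \<delta> j * (vt j \<bullet> z)) = sqrt (real n + 1) * snd z"
proof -
  have n0: "0 < n" using n by simp
  have fin: "finite J" and c: "\<And>j. j \<in> J \<Longrightarrow> 0 < c j" and v1: "\<And>j. j \<in> J \<Longrightarrow> v j \<bullet> v j = 1"
    using dec by (auto simp: identity_decomposition_def dot_square_norm)
  have sumc: "(\<Sum>j\<in>J. c j) = real n" using identity_decomposition_sum_weights[OF dec] n by simp
  have cent: "(\<Sum>j\<in>J. c j * (v j \<bullet> x)) = 0" for x
    using arg_cong[OF centred, of "\<lambda>y. y \<bullet> x"] by (simp add: inner_sum_left)
  have vt_inner: "vt j \<bullet> z = (snd z - sqrt (real n) * (v j \<bullet> fst z)) / sqrt (real n + 1)" for j z
    using john_lift_inner[OF n0, of "v j" "fst z" "snd z"] by (simp add: vt_def)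
  have inner: "(\<Sum>j\<in>J. \<delta> j * (vt j \<bullet> z) * (vt j \<bullet> z')) = z \<bullet> z'" for z z'
  proof -
    have "\<delta> j * (vt j \<bullet> z) * (vt j \<bullet> z') = snd z * snd z' / real n * c j
        - (snd z' / sqrt (real n)) * (c j * (v j \<bullet> fst z)) - (snd z / sqrt (real n)) * (c j * (v j \<bullet> fst z'))
        + c j * (v j \<bullet> fst z) * (v j \<bullet> fst z')" for j
    proof -
      define a where "a = sqrt (real n)"
      define b where "b = sqrt (real n + 1)"
      have ab: "0 < a" "real n = a * a" "0 < b" "real n + 1 = b * b" using n0 by (simp_all add: a_def b_def)
      show ?thesis
        unfolding vt_inner \<delta>_def a_def[symmetric] b_def[symmetric] ab(4) unfolding ab(2)
        using ab(1,3) by (simp add: field_simps)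
    qed
    then have "(\<Sum>j\<in>J. \<delta> j * (vt j \<bullet> z) * (vt j \<bullet> z')) = snd z * snd z' / real n * (\<Sum>j\<in>J. c j)
        - (snd z' / sqrt (real n)) * (\<Sum>j\<in>J. c j * (v j \<bullet> fst z)) - (snd z / sqrt (real n)) * (\<Sum>j\<in>J. c j * (v j \<bullet> fst z'))
        + (\<Sum>j\<in>J. c j * (v j \<bullet> fst z) * (v j \<bullet> fst z'))"
      by (simp only: sum.distrib sum_subtractf sum_distrib_left)
    also have "\<dots> = snd z * snd z' + fst z \<bullet> fst z'"
      using n0 by (simp add: sumc cent identity_decomposition_inner[OF dec])
    finally show ?thesis by (simp add: inner_prod_def)
  qed
  show "identity_decomposition UNIV J \<delta> vt"
    unfolding identity_decomposition_def
  proof (intro conjI ballI)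
    show "(\<Sum>j\<in>J. (\<delta> j * (vt j \<bullet> x)) *\<^sub>R vt j) = x" for x
      by (rule vector_eq_rdot[THEN iffD1, rule_format]) (simp add: inner_sum_left inner)
    show "0 < \<delta> j" if "j \<in> J" for j using c[OF that] n0 by (simp add: \<delta>_def)
    show "norm (vt j) = 1" if "j \<in> J" for j
    proof -
      have "(a *\<^sub>R (- x, b)) \<bullet> (a *\<^sub>R (- x, b)) = a\<^sup>2 * (x \<bullet> x + b\<^sup>2)" for a b :: real and x :: 'a
        by (simp add: inner_prod_def power2_eq_square algebra_simps)
      then have "vt j \<bullet> vt j = (sqrt (real n / (real n + 1)))\<^sup>2 * (v j \<bullet> v j + (1 / sqrt (real n))\<^sup>2)"
        unfolding vt_def .
      also have "\<dots> = (real n / (real n + 1)) * (1 + 1 / real n)"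
        using v1[OF that] n0 by (simp add: power_divide)
      also have "1 + 1 / real n = (real n + 1) / real n" using n0 by (simp add: add_divide_distrib)
      also have "real n / (real n + 1) * ((real n + 1) / real n) = 1" using n0 by simp
      finally show ?thesis by (simp add: norm_eq_sqrt_inner)
    qed
  qed (use fin in auto)
  have "(\<Sum>j\<in>J. \<delta> j * (vt j \<bullet> z))
      = (real n + 1) / (real n * sqrt (real n + 1)) * (snd z * (\<Sum>j\<in>J. c j) - sqrt (real n) * (\<Sum>j\<in>J. c j * (v j \<bullet> fst z)))"
  proof -
    have "p / q * \<gamma> * ((s - a * t) / b) = p / (q * b) * (s * \<gamma> - a * (\<gamma> * t))" for p q a b s t \<gamma> :: real
      by (simp add: algebra_simps diff_divide_distrib)
    then show ?thesis
      by (simp only: sum_distrib_left sum_subtractf[symmetric] vt_inner \<delta>_def)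
  qed
  also have "\<dots> = (real n + 1) / sqrt (real n + 1) * snd z" using n0 by (simp add: sumc cent)
  also have "(real n + 1) / sqrt (real n + 1) = sqrt (real n + 1)" by (rule real_div_sqrt) simp
  finally show "(\<Sum>j\<in>J. \<delta> j * (vt j \<bullet> z)) = sqrt (real n + 1) * snd z" .
qed

section \<open>Estimates of the constants\<close>

lemma ln_ge_chord:
  fixes x :: real
  assumes "1 \<le> x" "x \<le> 2"
  shows "(x - 1) * ln 2 \<le> ln x"
proof -
  have "(1 - (x - 1)) * ln 1 + (x - 1) * ln 2 \<le> ln ((1 - (x - 1)) * 1 + (x - 1) * 2)"
    using concave_onD[OF ln_concave, of "x - 1" 1 2] assms by simp
  then show ?thesis by (simp add: algebra_simps)
qed

text \<open>Apply the chord bound to \<open>x = s j / t j\<close> and multiply by \<open>t j\<close>.\<close>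

lemma prod_norm_ratio_le:
  fixes s t :: "'j \<Rightarrow> real"
  assumes fin: "finite J" and st: "\<And>j. j \<in> J \<Longrightarrow> 0 < t j \<and> t j \<le> s j \<and> s j \<le> 2 * t j"
  shows "(\<Prod>j\<in>J. sqrt (t j / s j) powr t j) \<le> 2 powr (((\<Sum>j\<in>J. t j) - (\<Sum>j\<in>J. s j)) / 2)"
proof -
  have factor: "sqrt (t j / s j) powr t j \<le> 2 powr ((t j - s j) / 2)" if "j \<in> J" for j
  proof -
    have t: "0 < t j" "0 < s j" and x: "1 \<le> s j / t j" "s j / t j \<le> 2"
      using st[OF that] by (auto simp: divide_le_eq le_divide_eq)
    have "(s j - t j) * ln 2 = t j * ((s j / t j - 1) * ln 2)" using t by (simp add: field_simps)
    also have "\<dots> \<le> t j * ln (s j / t j)" using ln_ge_chord[OF x] t by (intro mult_left_mono) auto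
    finally have "t j * ln (t j / s j) \<le> (t j - s j) * ln 2"
      using t by (simp add: ln_div algebra_simps)
    then show ?thesis
      using t by (simp add: powr_def ln_sqrt field_simps)
  qed
  have "(\<Prod>j\<in>J. sqrt (t j / s j) powr t j) \<le> (\<Prod>j\<in>J. 2 powr ((t j - s j) / 2))"
    by (intro prod_mono) (use factor in auto)
  also have "\<dots> = 2 powr (\<Sum>j\<in>J. (t j - s j) / 2)"
    using fin by (simp add: powr_sum)
  also have "(\<Sum>j\<in>J. (t j - s j) / 2) = ((\<Sum>j\<in>J. t j) - (\<Sum>j\<in>J. s j)) / 2"
    by (simp add: sum_divide_distrib[symmetric] sum_subtractf)
  finally show ?thesis .
qed

text \<open>With \<open>N = 2 k - n + 1\<close> and \<open>M = m - 2 (n - k)\<close> the hypotheses say \<open>N \<le> M \<le> 2 N\<close>, and the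
  chord bound applies to \<open>M / N\<close>.\<close>

lemma two_powr_le_bound:
  fixes n k m :: real
  assumes "n + 1 \<le> m" "m \<le> 2 * (k + 1)"
  shows "2 powr ((k - n) / 2) \<le> 2 powr ((k + 1 - m) / 2)
    * (if 2 * k - n + 1 = 0 then 1
       else ((2 * k - n + 1) / (m - 2 * (n - k))) powr (- ((2 * k - n + 1) / 2)))"
proof (cases "2 * k - n + 1 = 0")
  case True
  then have "2 * (k + 1) = n + 1" by (simp add: algebra_simps)
  then have "m = n + 1" using assms by simp
  then show ?thesis using True by simp
next
  case False
  define N where "N = 2 * k - n + 1"
  define M where "M = m - 2 * (n - k)"
  have N: "0 < N" "N \<le> M" "M \<le> 2 * N" using assms False by (auto simp: N_def M_def)
  have x: "1 \<le> M / N" "M / N \<le> 2" using N by (auto simp: divide_le_eq le_divide_eq)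
  have "(M - N) / 2 * ln 2 = N / 2 * ((M / N - 1) * ln 2)" using N by (simp add: field_simps)
  also have "\<dots> \<le> N / 2 * ln (M / N)" using ln_ge_chord[OF x] N by (intro mult_left_mono) auto
  also have "\<dots> = - (N / 2) * ln (N / M)"
  proof -
    have "ln (M / N) = - ln (N / M)" using N by (simp add: ln_div)
    then show ?thesis by simp
  qed
  finally have "2 powr ((M - N) / 2) \<le> (N / M) powr (- (N / 2))"
    using N by (simp add: powr_def)
  then have "2 powr ((k + 1 - m) / 2) * 2 powr ((M - N) / 2) \<le> 2 powr ((k + 1 - m) / 2) * (N / M) powr (- (N / 2))"
    by (intro mult_left_mono) auto
  also have "2 powr ((k + 1 - m) / 2) * 2 powr ((M - N) / 2) = 2 powr ((k - n) / 2)"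
  proof -
    have "(k + 1 - m) / 2 + (M - N) / 2 = (k - n) / 2" by (simp add: M_def N_def field_simps)
    then show ?thesis by (simp only: powr_add[symmetric])
  qed
  finally show ?thesis using False unfolding N_def M_def by (simp only: if_False)
qed

section \<open>Sections of a body in John's position\<close>

theorem theorem18:
  fixes K H S :: "(real^'n) set"
    and F :: "((real^'n) \<times> real) set"
    and c \<delta> \<delta>t :: "nat \<Rightarrow> real"
    and v :: "nat \<Rightarrow> real^'n"
    and vt :: "nat \<Rightarrow> (real^'n) \<times> real"
    and n k m :: nat
  assumes n: "n = CARD('n)"
    and K: "compact K" "convex K" "interior K \<noteq> {}" "johns_position UNIV K"
    and decomp: "john_decomposition K m c v"
    and H: "subspace H" "dim H = k"
    and S: "regular_simplex k S" "S \<subseteq> H" "johns_position H S"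
    and F: "F = H \<times> UNIV"
    and vt: "\<forall>j\<in>{1..m}. vt j = sqrt (real n / (real n + 1)) *\<^sub>R (- v j, 1 / sqrt (real n))"
    and \<delta>: "\<forall>j\<in>{1..m}. \<delta> j = (real n + 1) / real n * c j"
    and \<delta>t: "\<forall>j\<in>{1..m}. \<delta>t j = \<delta> j * (norm (orth_proj F (vt j)))\<^sup>2"
    and half: "\<forall>j\<in>{1..m}. \<delta>t j \<ge> 1 / 2"
  shows "measure (subspace_lborel H) (K \<inter> H)
     \<le> measure (subspace_lborel H) S
        * 2 powr ((real k + 1 - real m) / 2)
        * ((sqrt (real n) ^ k * sqrt (real n + 1) ^ (k + 1))
            / (sqrt (real k) ^ k * sqrt (real k + 1) ^ (k + 1)))
        * (if 2 * real k - real n + 1 = 0 then 1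
           else ((2 * real k - real n + 1) / (real m - 2 * (real n - real k)))
                  powr (- ((2 * real k - real n + 1) / 2)))"
proof -
  let ?J = "{1..m}"
  have n0: "0 < n" using n by simp
  have ballK: "cball 0 1 \<subseteq> K" using K(4) by (simp add: johns_position_def)
  have v: "v j \<in> frontier K" "norm (v j) = 1" if "j \<in> ?J" for j
    using decomp that by (auto simp: john_decomposition_def)
  have dec: "identity_decomposition UNIV ?J c v"
    using decomp v by (auto simp: john_decomposition_def identity_decomposition_def fun_eq_iff)
  have centred: "(\<Sum>j\<in>?J. c j *\<^sub>R v j) = 0" using decomp by (simp add: john_decomposition_def)
  have n': "n = DIM(real^'n)" using n by simp
  have dec_lift: "identity_decomposition UNIV ?J \<delta> vt"
    by (rule identity_decomposition_cong[OF john_lift_decomposition(1)[OF dec centred n']])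
      (use vt \<delta> in \<open>simp_all only:\<close>)
  have height: "(\<Sum>j\<in>?J. \<delta> j * (vt j \<bullet> z)) = sqrt (real n + 1) * snd z" for z
    unfolding john_lift_decomposition(2)[OF dec centred n', of z, symmetric]
    by (intro sum.cong refl) (use vt \<delta> in \<open>simp only:\<close>)
  have sF: "subspace F" and dF: "dim F = k + 1"
    using H F by (simp_all add: subspace_Times dim_Times_UNIV_real)
  define w where "w j = orth_proj F (vt j)" for j
  have \<delta>_pos: "0 < \<delta> j" and vt1: "norm (vt j) = 1" if "j \<in> ?J" for j
    using dec_lift that by (auto simp: identity_decomposition_def)
  have \<delta>t_w: "\<delta>t j = \<delta> j * (norm (w j))\<^sup>2" if "j \<in> ?J" for j using \<delta>t that by (simp add: w_def)
  have w_nz: "w j \<noteq> 0" if "j \<in> ?J" for j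
    using \<delta>t_w[OF that] half that by fastforce
  have dec_F: "identity_decomposition F ?J \<delta>t (\<lambda>j. w j /\<^sub>R norm (w j))"
    by (rule identity_decomposition_cong[OF identity_decomposition_orth_proj[OF dec_lift sF]])
      (use w_nz \<delta>t_w in \<open>simp_all only: w_def not_False_eq_True\<close>)
  have sum_\<delta>: "(\<Sum>j\<in>?J. \<delta> j) = real n + 1"
    using identity_decomposition_sum_weights[OF dec_lift] n by simp
  have sum_\<delta>t: "(\<Sum>j\<in>?J. \<delta>t j) = real k + 1"
    using identity_decomposition_sum_weights[OF dec_F sF] dF by simp
  have \<delta>_le: "\<delta> j \<le> 1" if "j \<in> ?J" for j
    by (rule identity_decomposition_weight_le_1[OF dec_lift that])
  have \<delta>t_le: "\<delta>t j \<le> \<delta> j" if "j \<in> ?J" for j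
  proof -
    have "norm (w j) \<le> 1" using norm_orth_proj_le[OF sF, of "vt j"] vt1[OF that] by (simp add: w_def)
    then have "(norm (w j))\<^sup>2 \<le> 1" by (simp add: power_le_one)
    then show ?thesis using \<delta>t_w[OF that] \<delta>_pos[OF that] by (simp add: mult_left_le)
  qed
  have m_ge: "real n + 1 \<le> real m"
    using sum_mono[of ?J \<delta> "\<lambda>_. 1"] \<delta>_le sum_\<delta> by simp
  have m_le: "real m \<le> 2 * (real k + 1)"
    using sum_mono[of ?J "\<lambda>_. 1 / 2" \<delta>t] half sum_\<delta>t by simp
  have norm_w: "norm (w j) = sqrt (\<delta>t j / \<delta> j)" if "j \<in> ?J" for j
    using \<delta>t_w[OF that] \<delta>_pos[OF that] by simp

  \<comment> \<open>With these rates, \<open>\<delta>t j * a j * (u j \<bullet> z) = \<delta> j * (vt j \<bullet> z)\<close> for \<open>z \<in> F\<close>.\<close>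
  let ?a = "\<lambda>j. 1 / norm (w j)"
  let ?u = "\<lambda>j. w j /\<^sub>R norm (w j)"
  let ?KH = "K \<inter> H"
  have KH: "?KH \<in> sets borel"
    using compact_imp_closed[OF K(1)] closed_subspace[OF H(1)] by (intro borel_closed closed_Int)
  have key: "(1 / (1 / sqrt (real n) * snd z)) *\<^sub>R fst z \<in> ?KH \<Longrightarrow> 0 < snd z \<Longrightarrow> j \<in> ?J \<Longrightarrow> 0 \<le> vt j \<bullet> z"
    for z :: "(real^'n) \<times> real" and j
  proof -
    assume z: "(1 / (1 / sqrt (real n) * snd z)) *\<^sub>R fst z \<in> ?KH" "0 < snd z" and j: "j \<in> ?J"
    have "v j \<bullet> ((1 / (1 / sqrt (real n) * snd z)) *\<^sub>R fst z) \<le> 1"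
      using contact_point_halfspace[OF K(2) ballK v[OF j]] z(1) by blast
    then have "sqrt (real n) * (v j \<bullet> fst z) \<le> snd z" using z(2) n0 by (simp add: field_simps)
    then show ?thesis
      using john_lift_inner[OF n0, of "v j" "fst z" "snd z"] vt j by simp
  qed
  have "ennreal ((1 / sqrt (real n)) ^ k * fact k / sqrt (real n + 1) ^ (k + 1)) * emeasure (subspace_lborel H) ?KH
      = (\<integral>\<^sup>+z. ennreal (exp (- sqrt (real n + 1) * snd z))
          * indicator {z. 0 < snd z \<and> (1 / (1 / sqrt (real n) * snd z)) *\<^sub>R fst z \<in> ?KH} z \<partial>subspace_lborel F)"
    unfolding F by (rule nn_integral_cone[OF H KH, symmetric]) (use n0 in auto)
  also have "\<dots> \<le> (\<integral>\<^sup>+z. ennreal (exp (- (\<Sum>j\<in>?J. \<delta>t j * ?a j * (?u j \<bullet> z))))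
      * indicator {z. \<forall>j\<in>?J. 0 \<le> ?u j \<bullet> z} z \<partial>subspace_lborel F)"
  proof (rule nn_integral_mono_AE, rule eventually_mono[OF AE_subspace_lborel_mem[OF sF]])
    fix z assume z: "z \<in> F"
    have wz: "w j \<bullet> z = vt j \<bullet> z" for j using orth_proj(2)[OF sF z] by (simp add: w_def)
    have "(\<Sum>j\<in>?J. \<delta>t j * ?a j * (?u j \<bullet> z)) = (\<Sum>j\<in>?J. \<delta> j * (vt j \<bullet> z))"
      using w_nz by (intro sum.cong refl) (simp add: \<delta>t_w wz power2_eq_square)
    then have 1: "(\<Sum>j\<in>?J. \<delta>t j * ?a j * (?u j \<bullet> z)) = sqrt (real n + 1) * snd z" by (simp only: height)
    have 2: "0 \<le> ?u j \<bullet> z" if "0 \<le> vt j \<bullet> z" for j using that by (simp add: wz)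
    show "ennreal (exp (- sqrt (real n + 1) * snd z))
          * indicator {z. 0 < snd z \<and> (1 / (1 / sqrt (real n) * snd z)) *\<^sub>R fst z \<in> ?KH} z
        \<le> ennreal (exp (- (\<Sum>j\<in>?J. \<delta>t j * ?a j * (?u j \<bullet> z)))) * indicator {z. \<forall>j\<in>?J. 0 \<le> ?u j \<bullet> z} z"
      unfolding 1
    proof (rule mult_mono)
      show "indicator {z. 0 < snd z \<and> (1 / (1 / sqrt (real n) * snd z)) *\<^sub>R fst z \<in> ?KH} z
          \<le> (indicator {z. \<forall>j\<in>?J. 0 \<le> ?u j \<bullet> z} z :: ennreal)"
        by (rule indicator_leI) (use key[of z] 2 in blast)
    qed simp_all
  qed
  also have "\<dots> \<le> ennreal (\<Prod>j\<in>?J. ?a j powr (- \<delta>t j))"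
  \<comment> \<open>Any well-ordered index type of size at least \<open>k + 1\<close> will do; \<open>'n bit1\<close> has \<open>2 n + 1\<close> elements.\<close>
  proof (rule brascamp_lieb_exponential[where 'd = "'n bit1", OF sF _ dec_F])
    have "k \<le> n" using dim_subset_UNIV[of H] H(2) n by simp
    then show "dim F \<le> CARD('n bit1)" using dF n by simp
  qed (use w_nz in simp)
  also have "(\<Prod>j\<in>?J. ?a j powr (- \<delta>t j)) = (\<Prod>j\<in>?J. sqrt (\<delta>t j / \<delta> j) powr \<delta>t j)"
    using w_nz by (intro prod.cong refl) (simp add: norm_w[symmetric] powr_minus powr_divide)
  also have "ennreal \<dots> \<le> ennreal (2 powr ((real k - real n) / 2))"
  proof (rule ennreal_leI)
    have "(\<Prod>j\<in>?J. sqrt (\<delta>t j / \<delta> j) powr \<delta>t j) \<le> 2 powr (((\<Sum>j\<in>?J. \<delta>t j) - (\<Sum>j\<in>?J. \<delta> j)) / 2)"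
    proof (rule prod_norm_ratio_le)
      fix j assume j: "j \<in> ?J"
      have "1 / 2 \<le> \<delta>t j" using half j by blast
      then show "0 < \<delta>t j \<and> \<delta>t j \<le> \<delta> j \<and> \<delta> j \<le> 2 * \<delta>t j" using \<delta>t_le[OF j] \<delta>_le[OF j] by linarith
    qed simp
    then show "(\<Prod>j\<in>?J. sqrt (\<delta>t j / \<delta> j) powr \<delta>t j) \<le> 2 powr ((real k - real n) / 2)"
      by (simp only: sum_\<delta> sum_\<delta>t add_diff_cancel_right)
  qed
  finally have main: "ennreal ((1 / sqrt (real n)) ^ k * fact k / sqrt (real n + 1) ^ (k + 1))
      * emeasure (subspace_lborel H) ?KH \<le> ennreal (2 powr ((real k - real n) / 2))" .
  have fin: "emeasure (subspace_lborel H) ?KH = ennreal (measure (subspace_lborel H) ?KH)"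
  proof -
    have "bounded ?KH" using compact_imp_bounded[OF K(1)] bounded_subset by blast
    then show ?thesis
      using emeasure_subspace_lborel_bounded[OF H(1), of ?KH] by (intro emeasure_eq_ennreal_measure) auto
  qed
  define \<nu> where "\<nu> = sqrt (real n) ^ k * sqrt (real n + 1) ^ (k + 1)"
  define \<kappa> where "\<kappa> = sqrt (real k) ^ k * sqrt (real k + 1) ^ (k + 1)"
  have "0 < sqrt (real k) ^ k" by (cases "k = 0") auto
  then have pos: "0 < \<nu>" "0 < \<kappa>" using n0 by (auto simp: \<nu>_def \<kappa>_def)
  have "fact k / \<nu> * measure (subspace_lborel H) ?KH \<le> 2 powr ((real k - real n) / 2)"
    using main n0 by (simp add: fin ennreal_mult'[symmetric] \<nu>_def power_divide)
  then have upper: "measure (subspace_lborel H) ?KH \<le> \<nu> / fact k * 2 powr ((real k - real n) / 2)"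
    using pos by (simp add: field_simps)
  have lower: "\<kappa> / fact k \<le> measure (subspace_lborel H) S"
    unfolding \<kappa>_def using S(3) by (intro measure_regular_simplex_ge[OF H S(1,2)]) (simp add: johns_position_def)
  let ?Y = "if 2 * real k - real n + 1 = 0 then 1
           else ((2 * real k - real n + 1) / (real m - 2 * (real n - real k)))
                  powr (- ((2 * real k - real n + 1) / 2))"
  have "measure (subspace_lborel H) ?KH \<le> (\<kappa> / fact k) * (\<nu> / \<kappa>) * 2 powr ((real k - real n) / 2)"
    using upper pos by simp
  also have "\<dots> \<le> measure (subspace_lborel H) S * (\<nu> / \<kappa>) * (2 powr ((real k + 1 - real m) / 2) * ?Y)"
    using lower pos two_powr_le_bound[OF m_ge m_le]
    by (intro mult_mono) (auto intro!: mult_nonneg_nonneg)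
  finally show ?thesis by (simp add: \<nu>_def \<kappa>_def mult_ac)
qed

end
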